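(* The category $\mathsf{Diff}'$ of classical diffeological spaces is equivalent to the category $\mathsf{Diff}$ of diffeological spaces (defined by plots on cartesian spaces and good open covers).
   Context: A cartesian space is a smooth manifold diffeomorphic to $\mathbb{R}^n$ for some $n\ge0$. A good open cover of a manifold is an open cover by cartesian spaces all of whose finite non-empty intersections are cartesian spaces. $\mathsf{Diff}$: objects are sets $X$ with a collection of functions $p:U\to X$ with $U$ a cartesian space, called plots, such that (1) every map $\mathbb{R}^0\to X$ is a plot; (2) if $p:U\to X$ is a plot and $f:V\to U$ is a smooth map of cartesian spaces, then $pf$ is a plot; (3) if $U$ is a cartesian space, $p:U\to X$ a function and $\{U_i\subseteq U\}$ a good open cover with every $p|_{U_i}$ a plot, then $p$ is a plot. Morphisms are functions $f:X\to Y$ such that $fp$ is a plot of $Y$ for every plot $p$ of $X$. $\mathsf{Diff}'$ (classical diffeological spaces): objects are sets $X$ with a collection of functions $p:U\to X$, where $U$ ranges over open subsets of $\mathbb{R}^n$ for all $n\ge0$, called plots, such that (1) constant functions are plots; (2) if $p:U\to X$ is a plot and $f:V\to U$ is a smooth map from an open subset $V$ of some $\mathbb{R}^m$, then $pf$ is a plot; (3) if $p:U\to X$ is a function and every point of $U$ has an open neighbourhood $V\subseteq U$ with $p|_V$ a plot, then $p$ is a plot. Morphisms are functions $f$ such that $fp$ is a plot for every plot $p$. *)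

theory Defs
  imports "HOL-Analysis.Analysis"
begin

section \<open>Categories and equivalence of categories\<close>

text \<open>
  Hom-sets need not be disjoint, so composition and the action of a functor on arrows take the
  objects involved as arguments: \<open>Comp C X Y Z g f\<close> is \<open>g\<close> after \<open>f\<close> for \<open>f : X \<rightarrow> Y\<close>, \<open>g : Y \<rightarrow> Z\<close>.
\<close>

record ('o, 'a) cat =
  Obj :: "'o set"
  Hom :: "'o \<Rightarrow> 'o \<Rightarrow> 'a set"
  Idn :: "'o \<Rightarrow> 'a"
  Comp :: "'o \<Rightarrow> 'o \<Rightarrow> 'o \<Rightarrow> 'a \<Rightarrow> 'a \<Rightarrow> 'a"

definition category :: "('o, 'a) cat \<Rightarrow> bool" where
  "category C \<longleftrightarrow>
     (\<forall>X\<in>Obj C. Idn C X \<in> Hom C X X) \<and>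
     (\<forall>X\<in>Obj C. \<forall>Y\<in>Obj C. \<forall>Z\<in>Obj C. \<forall>f\<in>Hom C X Y. \<forall>g\<in>Hom C Y Z. Comp C X Y Z g f \<in> Hom C X Z) \<and>
     (\<forall>X\<in>Obj C. \<forall>Y\<in>Obj C. \<forall>f\<in>Hom C X Y.
        Comp C X X Y f (Idn C X) = f \<and> Comp C X Y Y (Idn C Y) f = f) \<and>
     (\<forall>W\<in>Obj C. \<forall>X\<in>Obj C. \<forall>Y\<in>Obj C. \<forall>Z\<in>Obj C. \<forall>f\<in>Hom C W X. \<forall>g\<in>Hom C X Y. \<forall>h\<in>Hom C Y Z.
        Comp C W Y Z h (Comp C W X Y g f) = Comp C W X Z (Comp C X Y Z h g) f)"

record ('o, 'a, 'p, 'b) ftor =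
  FObj :: "'o \<Rightarrow> 'p"
  FArr :: "'o \<Rightarrow> 'o \<Rightarrow> 'a \<Rightarrow> 'b"

definition is_functor :: "('o, 'a) cat \<Rightarrow> ('p, 'b) cat \<Rightarrow> ('o, 'a, 'p, 'b) ftor \<Rightarrow> bool" where
  "is_functor C D F \<longleftrightarrow>
     (\<forall>X\<in>Obj C. FObj F X \<in> Obj D) \<and>
     (\<forall>X\<in>Obj C. \<forall>Y\<in>Obj C. \<forall>f\<in>Hom C X Y. FArr F X Y f \<in> Hom D (FObj F X) (FObj F Y)) \<and>
     (\<forall>X\<in>Obj C. FArr F X X (Idn C X) = Idn D (FObj F X)) \<and>
     (\<forall>X\<in>Obj C. \<forall>Y\<in>Obj C. \<forall>Z\<in>Obj C. \<forall>f\<in>Hom C X Y. \<forall>g\<in>Hom C Y Z.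
        FArr F X Z (Comp C X Y Z g f) =
        Comp D (FObj F X) (FObj F Y) (FObj F Z) (FArr F Y Z g) (FArr F X Y f))"

definition id_ftor :: "('o, 'a, 'o, 'a) ftor" where
  "id_ftor = \<lparr>FObj = (\<lambda>X. X), FArr = (\<lambda>X Y f. f)\<rparr>"

definition comp_ftor ::
    "('p, 'b, 'q, 'c) ftor \<Rightarrow> ('o, 'a, 'p, 'b) ftor \<Rightarrow> ('o, 'a, 'q, 'c) ftor" where
  "comp_ftor G F = \<lparr>FObj = (\<lambda>X. FObj G (FObj F X)),
                    FArr = (\<lambda>X Y f. FArr G (FObj F X) (FObj F Y) (FArr F X Y f))\<rparr>"

definition is_iso :: "('o, 'a) cat \<Rightarrow> 'o \<Rightarrow> 'o \<Rightarrow> 'a \<Rightarrow> bool" where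
  "is_iso C X Y f \<longleftrightarrow> f \<in> Hom C X Y \<and>
     (\<exists>g\<in>Hom C Y X. Comp C X Y X g f = Idn C X \<and> Comp C Y X Y f g = Idn C Y)"

definition natural_iso ::
    "('o, 'a) cat \<Rightarrow> ('p, 'b) cat \<Rightarrow> ('o, 'a, 'p, 'b) ftor \<Rightarrow> ('o, 'a, 'p, 'b) ftor \<Rightarrow>
     ('o \<Rightarrow> 'b) \<Rightarrow> bool" where
  "natural_iso C D F G \<eta> \<longleftrightarrow>
     (\<forall>X\<in>Obj C. is_iso D (FObj F X) (FObj G X) (\<eta> X)) \<and>
     (\<forall>X\<in>Obj C. \<forall>Y\<in>Obj C. \<forall>f\<in>Hom C X Y.
        Comp D (FObj F X) (FObj F Y) (FObj G Y) (\<eta> Y) (FArr F X Y f) =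
        Comp D (FObj F X) (FObj G X) (FObj G Y) (FArr G X Y f) (\<eta> X))"

definition equivalent_categories :: "('o, 'a) cat \<Rightarrow> ('p, 'b) cat \<Rightarrow> bool" where
  "equivalent_categories C D \<longleftrightarrow> category C \<and> category D \<and>
     (\<exists>F G \<eta> \<epsilon>. is_functor C D F \<and> is_functor D C G \<and>
        natural_iso C C id_ftor (comp_ftor G F) \<eta> \<and>
        natural_iso D D (comp_ftor F G) id_ftor \<epsilon>)"


section \<open>Smooth maps between open subsets of Euclidean spaces\<close>

text \<open>
  \<open>\<real>\<^sup>n\<close> is \<^const>\<open>Euclidean_space\<close>: the real sequences vanishing from index \<open>n\<close> on.
  \<open>Ck_on k m S f\<close> says that all partial derivatives of \<open>f\<close> of order at most \<open>k\<close> exist and are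
  continuous on \<open>S\<close>, where \<open>S\<close> is meant to be open in \<open>\<real>\<^sup>m\<close>. Only \<open>f\<close> on \<open>S\<close> matters then.
\<close>

primrec Ck_on :: "nat \<Rightarrow> nat \<Rightarrow> (nat \<Rightarrow> real) set \<Rightarrow> ((nat \<Rightarrow> real) \<Rightarrow> real) \<Rightarrow> bool" where
  "Ck_on 0 m S f \<longleftrightarrow> continuous_on S f"
| "Ck_on (Suc k) m S f \<longleftrightarrow> continuous_on S f \<and>
     (\<exists>D. \<forall>i<m. (\<forall>x\<in>S. ((\<lambda>t. f (x(i := t))) has_real_derivative D i x) (at (x i))) \<and>
                 Ck_on k m S (D i))"

definition smooth_on ::
    "nat \<Rightarrow> nat \<Rightarrow> (nat \<Rightarrow> real) set \<Rightarrow> ((nat \<Rightarrow> real) \<Rightarrow> (nat \<Rightarrow> real)) \<Rightarrow> bool" where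
  "smooth_on m n S f \<longleftrightarrow> f ` S \<subseteq> topspace (Euclidean_space n) \<and>
     (\<forall>j<n. \<forall>k. Ck_on k m S (\<lambda>x. f x j))"


section \<open>Smooth manifolds and cartesian spaces\<close>

type_synonym 'm chart = "'m set \<times> ('m \<Rightarrow> nat \<Rightarrow> real)"

record 'm mfd =
  mtop :: "'m topology"
  mdim :: nat
  atlas :: "'m chart set"

text \<open>Charts are required to be extensional so that a manifold determines its maximal atlas.\<close>

definition is_chart :: "'m topology \<Rightarrow> nat \<Rightarrow> 'm chart \<Rightarrow> bool" where
  "is_chart T n = (\<lambda>(U, \<phi>). openin T U \<and> \<phi> \<in> extensional U \<and> openin (Euclidean_space n) (\<phi> ` U) \<and>
     homeomorphic_map (subtopology T U) (subtopology (Euclidean_space n) (\<phi> ` U)) \<phi>)"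

definition compatible :: "nat \<Rightarrow> 'm chart \<Rightarrow> 'm chart \<Rightarrow> bool" where
  "compatible n = (\<lambda>(U, \<phi>) (V, \<psi>).
     smooth_on n n (\<phi> ` (U \<inter> V)) (\<psi> \<circ> inv_into U \<phi>) \<and>
     smooth_on n n (\<psi> ` (U \<inter> V)) (\<phi> \<circ> inv_into V \<psi>))"

definition smooth_manifold :: "'m mfd \<Rightarrow> bool" where
  "smooth_manifold M \<longleftrightarrow>
     Hausdorff_space (mtop M) \<and> second_countable (mtop M) \<and>
     (\<forall>c\<in>atlas M. is_chart (mtop M) (mdim M) c) \<and>
     (\<Union>(U, \<phi>)\<in>atlas M. U) = topspace (mtop M) \<and>
     (\<forall>c\<in>atlas M. \<forall>d\<in>atlas M. compatible (mdim M) c d) \<and>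
     (\<forall>c. is_chart (mtop M) (mdim M) c \<and> (\<forall>d\<in>atlas M. compatible (mdim M) c d) \<longrightarrow> c \<in> atlas M)"

abbreviation points :: "'m mfd \<Rightarrow> 'm set" where
  "points M \<equiv> topspace (mtop M)"

definition smooth_map :: "'m mfd \<Rightarrow> 'k mfd \<Rightarrow> ('m \<Rightarrow> 'k) \<Rightarrow> bool" where
  "smooth_map M N f \<longleftrightarrow> continuous_map (mtop M) (mtop N) f \<and>
     (\<forall>(U, \<phi>)\<in>atlas M. \<forall>(V, \<psi>)\<in>atlas N.
        smooth_on (mdim M) (mdim N) (\<phi> ` (U \<inter> f -` V)) (\<psi> \<circ> f \<circ> inv_into U \<phi>))"

definition diffeomorphic :: "'m mfd \<Rightarrow> 'k mfd \<Rightarrow> bool" where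
  "diffeomorphic M N \<longleftrightarrow> (\<exists>f g. smooth_map M N f \<and> smooth_map N M g \<and>
     (\<forall>x\<in>points M. g (f x) = x) \<and> (\<forall>y\<in>points N. f (g y) = y))"

text \<open>\<open>\<real>\<^sup>n\<close> with the maximal atlas containing the identity chart.\<close>

definition Rn :: "nat \<Rightarrow> (nat \<Rightarrow> real) mfd" where
  "Rn n = \<lparr>mtop = Euclidean_space n, mdim = n,
     atlas = {c. is_chart (Euclidean_space n) n c \<and>
       compatible n c (topspace (Euclidean_space n), restrict id (topspace (Euclidean_space n)))}\<rparr>"

definition cartesian_space :: "'m mfd \<Rightarrow> bool" where
  "cartesian_space M \<longleftrightarrow> smooth_manifold M \<and> (\<exists>n. diffeomorphic M (Rn n))"

text \<open>The manifold structure on an open subset \<open>W\<close>: the charts of \<open>M\<close> with domain inside \<open>W\<close>.\<close>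

definition open_submfd :: "'m mfd \<Rightarrow> 'm set \<Rightarrow> 'm mfd" where
  "open_submfd M W = \<lparr>mtop = subtopology (mtop M) W, mdim = mdim M,
                      atlas = {c \<in> atlas M. fst c \<subseteq> W}\<rparr>"

text \<open>
  As usual for good covers, a finite intersection is required to be cartesian unless it is
  the empty set (which is not a cartesian space).
\<close>

definition good_open_cover :: "'m mfd \<Rightarrow> 'm set set \<Rightarrow> bool" where
  "good_open_cover M \<U> \<longleftrightarrow>
     (\<forall>W\<in>\<U>. openin (mtop M) W \<and> cartesian_space (open_submfd M W)) \<and>
     \<Union>\<U> = points M \<and>
     (\<forall>\<F>. finite \<F> \<and> \<F> \<noteq> {} \<and> \<F> \<subseteq> \<U> \<and> \<Inter>\<F> \<noteq> {} \<longrightarrow> cartesian_space (open_submfd M (\<Inter>\<F>)))"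


section \<open>The two categories of diffeological spaces\<close>

text \<open>
  Functions between sets are represented by extensional functions, and a plot is a function
  together with its domain. In \<open>Diff\<close> the domains are the cartesian spaces with points in \<open>'m\<close>.
  As \<open>\<real>\<^sup>0\<close> itself need not live on \<open>'m\<close>, the first axiom ranges over its copies there.
\<close>

definition diffeology :: "'x set \<Rightarrow> ('m mfd \<times> ('m \<Rightarrow> 'x)) set \<Rightarrow> bool" where
  "diffeology X P \<longleftrightarrow>
     (\<forall>(U, p)\<in>P. cartesian_space U \<and> p \<in> points U \<rightarrow>\<^sub>E X) \<and>
     (\<forall>U p. smooth_manifold U \<and> diffeomorphic U (Rn 0) \<and> p \<in> points U \<rightarrow>\<^sub>E X \<longrightarrow> (U, p) \<in> P) \<and>
     (\<forall>U p V f. (U, p) \<in> P \<and> cartesian_space V \<and> smooth_map V U f \<longrightarrow>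
        (V, compose (points V) p f) \<in> P) \<and>
     (\<forall>U p \<U>. cartesian_space U \<and> p \<in> points U \<rightarrow>\<^sub>E X \<and> good_open_cover U \<U> \<and>
        (\<forall>W\<in>\<U>. (open_submfd U W, restrict p W) \<in> P) \<longrightarrow> (U, p) \<in> P)"

text \<open>
  A classical plot also records the dimension \<open>n\<close> of the space \<open>\<real>\<^sup>n\<close> in which its domain is open;
  the domain does not determine it when it is empty.
\<close>

definition classical_diffeology ::
    "'x set \<Rightarrow> (nat \<times> (nat \<Rightarrow> real) set \<times> ((nat \<Rightarrow> real) \<Rightarrow> 'x)) set \<Rightarrow> bool" where
  "classical_diffeology X P \<longleftrightarrow>
     (\<forall>(n, U, p)\<in>P. openin (Euclidean_space n) U \<and> p \<in> U \<rightarrow>\<^sub>E X) \<and>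
     (\<forall>n U. \<forall>c\<in>X. openin (Euclidean_space n) U \<longrightarrow> (n, U, \<lambda>u\<in>U. c) \<in> P) \<and>
     (\<forall>n U p m V f. (n, U, p) \<in> P \<and> openin (Euclidean_space m) V \<and> smooth_on m n V f \<and> f ` V \<subseteq> U \<longrightarrow>
        (m, V, compose V p f) \<in> P) \<and>
     (\<forall>n U p. openin (Euclidean_space n) U \<and> p \<in> U \<rightarrow>\<^sub>E X \<and>
        (\<forall>u\<in>U. \<exists>V. openin (Euclidean_space n) V \<and> u \<in> V \<and> V \<subseteq> U \<and> (n, V, restrict p V) \<in> P) \<longrightarrow>
        (n, U, p) \<in> P)"

definition Diff :: "('x set \<times> ('m mfd \<times> ('m \<Rightarrow> 'x)) set, 'x \<Rightarrow> 'x) cat" where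
  "Diff = \<lparr>Obj = {(X, P). diffeology X P},
     Hom = (\<lambda>(X, P) (Y, Q). {f \<in> X \<rightarrow>\<^sub>E Y. \<forall>(U, p)\<in>P. (U, compose (points U) f p) \<in> Q}),
     Idn = (\<lambda>(X, P). \<lambda>x\<in>X. x),
     Comp = (\<lambda>(X, P) (Y, Q) (Z, R) g f. compose X g f)\<rparr>"

definition classical_Diff ::
    "('x set \<times> (nat \<times> (nat \<Rightarrow> real) set \<times> ((nat \<Rightarrow> real) \<Rightarrow> 'x)) set, 'x \<Rightarrow> 'x) cat" where
  "classical_Diff = \<lparr>Obj = {(X, P). classical_diffeology X P},
     Hom = (\<lambda>(X, P) (Y, Q). {f \<in> X \<rightarrow>\<^sub>E Y. \<forall>(n, U, p)\<in>P. (n, U, compose U f p) \<in> Q}),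
     Idn = (\<lambda>(X, P). \<lambda>x\<in>X. x),
     Comp = (\<lambda>(X, P) (Y, Q) (Z, R) g f. compose X g f)\<rparr>"

end

theory Submission
  imports Defs
begin

text \<open>
  A classical diffeology determines the plots on a cartesian space \<open>U\<close>: a function on \<open>U\<close> is a plot
  iff its composites with all smooth maps from open subsets of \<open>\<real>\<^sup>n\<close> to \<open>U\<close> are. In the other
  direction, test a function on an open subset of \<open>\<real>\<^sup>n\<close> with all smooth maps from cartesian spaces.
  These constructions are mutually inverse on objects and do not change the underlying functions, so
  the equivalence is even an isomorphism of categories.

  The point of substance is that a function on an open subset of \<open>\<real>\<^sup>n\<close> which is locally a plot is
  a plot: every open cover of a cartesian space must be refined by a good open cover. Open boxes in
  \<open>\<real>\<^sup>n\<close> do this, because a finite intersection of boxes is a box, and a nonempty box is diffeomorphic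
  to \<open>\<real>\<^sup>n\<close> by the logistic function in each coordinate.

  The embedding of \<open>\<real>\<^sup>n\<close> into the type of points provides copies of \<open>\<real>\<^sup>n\<close> on that type. They are needed to
  recover a classical plot near a point, and for \<open>n = 0\<close> to see that constant functions are plots.
\<close>

subsection \<open>Open subsets of \<open>\<real>\<^sup>n\<close>\<close>

text \<open>The domains of the two kinds of plots live on different types,
  \<open>nat \<Rightarrow> real\<close> and \<open>'m\<close>, so neither class of plots arises by
  restricting the other. Testing with smooth maps crosses the types without choosing charts and
  makes closure under precomposition immediate. The round trips rest on factoring an identity map. A
  cartesian space has mutually inverse smooth maps to and from a Euclidean space, so one test map
  recovers a function on it. An open subset of Euclidean space is in general not cartesian, so there
  the factorization exists only on boxes, and locality has to glue the results.

  Most of the work lies below this level. Smoothness is given by iterated partial derivatives, so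
  the chain rule is derived from their continuity rather than from a total derivative. Atlases are
  maximal and smoothness of a map is demanded in every pair of charts, so everything is reduced to
  one chart near each point; that reduction requires \<open>Ck_on\<close> to be a local
  property.\<close>

abbreviation E :: "nat \<Rightarrow> (nat \<Rightarrow> real) set" where
  "E n \<equiv> topspace (Euclidean_space n)"

lemma in_E_iff: "x \<in> E n \<longleftrightarrow> (\<forall>i\<ge>n. x i = 0)"
  by (simp add: topspace_Euclidean_space)

lemma Euclidean_space_top_of_set: "Euclidean_space n = top_of_set (E n)"
  by (simp add: Euclidean_space_def euclidean_product_topology)

lemma openin_Euclidean_space: "openin (Euclidean_space n) S \<longleftrightarrow> (\<exists>T. open T \<and> S = E n \<inter> T)"
  by (metis Euclidean_space_top_of_set openin_open)

lemma E_fun_upd: "x \<in> E n \<Longrightarrow> i < n \<Longrightarrow> x(i := t) \<in> E n"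
  by (auto simp: in_E_iff)

text \<open>\<open>Ck_on\<close> differentiates along the line \<open>x(i := t)\<close>, which may
  leave \<open>S\<close>. Near \<open>x i\<close> it does not, since the line is continuous into the
  product topology. This is what makes partial derivatives depend only on the values on
  \<open>S\<close>.\<close>

lemma eventually_fun_upd_in:
  assumes "openin (Euclidean_space m) S" "x \<in> S" "i < m"
  shows "\<forall>\<^sub>F t in nhds (x i). x(i := t) \<in> S"
proof -
  obtain T where T: "open T" "S = E m \<inter> T"
    using assms(1) by (auto simp: openin_Euclidean_space)
  have "continuous_on UNIV (\<lambda>t. x(i := t))"
  proof (rule continuous_on_coordinatewise_then_product)
    fix j show "continuous_on UNIV (\<lambda>t. (x(i := t)) j)"
      by (cases "j = i") auto
  qed
  then have "open ((\<lambda>t. x(i := t)) -` T)"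
    using T(1) open_vimage by blast
  moreover have "x i \<in> (\<lambda>t. x(i := t)) -` T"
    using assms(2) T by simp
  ultimately have "\<forall>\<^sub>F t in nhds (x i). t \<in> (\<lambda>t. x(i := t)) -` T"
    using eventually_nhds by blast
  then show ?thesis
    by eventually_elim (use assms T E_fun_upd in auto)
qed

text \<open>A basic open set of the product topology constrains each coordinate separately. From
  index \<open>n\<close> on both points vanish, so only finitely many radii matter, and these have a
  positive minimum.\<close>

lemma openin_Euclidean_space_contains_box:
  assumes "openin (Euclidean_space n) T" "y \<in> T"
  obtains r where "r > 0" "\<And>z. z \<in> E n \<Longrightarrow> (\<And>i. i < n \<Longrightarrow> \<bar>z i - y i\<bar> < r) \<Longrightarrow> z \<in> T"
proof -
  obtain T' where T': "open T'" "T = E n \<inter> T'"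
    using assms(1) by (auto simp: openin_Euclidean_space)
  then have "openin (product_topology (\<lambda>i::nat. euclideanreal) UNIV) T'"
    by (simp add: open_fun_def)
  then obtain U where U: "\<And>i. open (U i)" "y \<in> Pi\<^sub>E UNIV U" "Pi\<^sub>E UNIV U \<subseteq> T'"
    using assms(2) T' product_topology_open_contains_basis[of "\<lambda>i. euclideanreal" UNIV T' y] by auto
  have "\<exists>r>0. ball (y i) r \<subseteq> U i" for i
    using U(1)[of i] U(2) open_contains_ball by (auto simp: PiE_iff)
  then obtain R where R: "\<And>i. R i > 0" "\<And>i. ball (y i) (R i) \<subseteq> U i"
    by metis
  \<comment> \<open>The inserted 1 keeps the set nonempty when \<open>n\<close> is 0.\<close>
  define r where "r = Min (insert 1 (R ` {..<n}))"
  have "r > 0"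
    using R(1) by (simp add: r_def)
  moreover have "z \<in> T" if z: "z \<in> E n" "\<And>i. i < n \<Longrightarrow> \<bar>z i - y i\<bar> < r" for z
  proof -
    have "z i \<in> U i" for i
    proof (cases "i < n")
      case True
      have "r \<le> R i" using True by (auto simp: r_def)
      with z(2)[OF True] have "z i \<in> ball (y i) (R i)"
        by (auto simp: dist_real_def)
      then show ?thesis using R(2) by blast
    next
      case False
      then have "z i = y i"
        using z(1) assms(2) T' by (auto simp: in_E_iff)
      then show ?thesis using U(2) by auto
    qed
    then show ?thesis using U(3) z(1) T' by blast
  qed
  ultimately show ?thesis using that by blast
qed

subsection \<open>Differentiable functions\<close>

lemma Ck_on_imp_continuous_on: "Ck_on k m S f \<Longrightarrow> continuous_on S f"
  by (cases k) auto

lemma Ck_on_SucE: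
  assumes "Ck_on (Suc k) m S f"
  obtains D where "\<And>i x. i < m \<Longrightarrow> x \<in> S \<Longrightarrow> ((\<lambda>t. f (x(i := t))) has_real_derivative D i x) (at (x i))"
    "\<And>i. i < m \<Longrightarrow> Ck_on k m S (D i)"
proof -
  obtain D where "\<forall>i<m. (\<forall>x\<in>S. ((\<lambda>t. f (x(i := t))) has_real_derivative D i x) (at (x i))) \<and> Ck_on k m S (D i)"
    using assms Ck_on.simps(2) by blast
  then show ?thesis using that by blast
qed

lemma Ck_on_SucI:
  assumes "continuous_on S f"
    and "\<And>i x. i < m \<Longrightarrow> x \<in> S \<Longrightarrow> ((\<lambda>t. f (x(i := t))) has_real_derivative D i x) (at (x i))"
    and "\<And>i. i < m \<Longrightarrow> Ck_on k m S (D i)"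
  shows "Ck_on (Suc k) m S f"
  using assms Ck_on.simps(2) by blast

lemma Ck_on_Suc_imp: "Ck_on (Suc k) m S f \<Longrightarrow> Ck_on k m S f"
proof (induction k arbitrary: f)
  case 0
  then show ?case by simp
next
  case (Suc k)
  obtain D where "\<And>i x. i < m \<Longrightarrow> x \<in> S \<Longrightarrow> ((\<lambda>t. f (x(i := t))) has_real_derivative D i x) (at (x i))"
    "\<And>i. i < m \<Longrightarrow> Ck_on (Suc k) m S (D i)"
    using Suc.prems Ck_on_SucE by blast
  then show ?case
    using Suc.IH Suc.prems Ck_on_imp_continuous_on by (intro Ck_on_SucI) blast+
qed

lemma Ck_on_subset: "Ck_on k m S f \<Longrightarrow> S' \<subseteq> S \<Longrightarrow> Ck_on k m S' f"
proof (induction k arbitrary: f)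
  case 0
  then show ?case by (auto intro: continuous_on_subset)
next
  case (Suc k)
  then obtain D where "\<And>i x. i < m \<Longrightarrow> x \<in> S \<Longrightarrow> ((\<lambda>t. f (x(i := t))) has_real_derivative D i x) (at (x i))"
    "\<And>i. i < m \<Longrightarrow> Ck_on k m S (D i)"
    using Ck_on_SucE by blast
  then show ?case
    using Suc Ck_on_imp_continuous_on continuous_on_subset by (intro Ck_on_SucI) blast+
qed

text \<open>A case distinction on \<open>k\<close> replaces induction: near each point of
  \<open>S\<close> the two functions agree along every coordinate line, so the derivative functions
  of \<open>f\<close> serve for \<open>g\<close> unchanged.\<close>

lemma Ck_on_cong:
  assumes "openin (Euclidean_space m) S" "Ck_on k m S f" "\<And>x. x \<in> S \<Longrightarrow> f x = g x"
  shows "Ck_on k m S g"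
proof (cases k)
  case 0
  then show ?thesis using assms continuous_on_cong by (metis Ck_on.simps(1))
next
  case (Suc k')
  then obtain D where D: "\<And>i x. i < m \<Longrightarrow> x \<in> S \<Longrightarrow> ((\<lambda>t. f (x(i := t))) has_real_derivative D i x) (at (x i))"
    "\<And>i. i < m \<Longrightarrow> Ck_on k' m S (D i)"
    using assms(2) by auto
  have "((\<lambda>t. g (x(i := t))) has_real_derivative D i x) (at (x i))" if "i < m" "x \<in> S" for i x
  proof -
    have "\<forall>\<^sub>F t in nhds (x i). f (x(i := t)) = g (x(i := t))"
      using eventually_fun_upd_in[OF assms(1) that(2,1)] by eventually_elim (rule assms(3))
    then show ?thesis using DERIV_cong_ev[OF refl _ refl] D(1)[OF that] by fast
  qed
  moreover have "continuous_on S g"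
    using assms Ck_on_imp_continuous_on continuous_on_cong by metis
  ultimately show ?thesis using D(2) Suc by auto
qed

text \<open>Each neighbourhood comes with its own derivative functions, while a single family on all
  of \<open>S\<close> is required. Derivatives being unique, every local family agrees with
  \<open>deriv\<close>, which serves as the global one.\<close>

lemma Ck_on_local:
  assumes "openin (Euclidean_space m) S"
    and "\<And>x. x \<in> S \<Longrightarrow> \<exists>S'. openin (Euclidean_space m) S' \<and> x \<in> S' \<and> S' \<subseteq> S \<and> Ck_on k m S' f"
  shows "Ck_on k m S f"
  using assms(2)
proof (induction k arbitrary: f)
  case 0
  have "continuous (at x within S) f" if x: "x \<in> S" for x
  proof -
    obtain S' where S': "openin (Euclidean_space m) S'" "x \<in> S'" "S' \<subseteq> S" "continuous_on S' f"
      using 0 x by auto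
    then obtain T where T: "open T" "S' = E m \<inter> T"
      by (auto simp: openin_Euclidean_space)
    have "S \<subseteq> E m" using assms(1) openin_subset by blast
    then have "at x within S = at x within S'"
      using S' T by (intro at_within_nhd[of x T]) auto
    then show ?thesis
      using S' continuous_on_eq_continuous_within by metis
  qed
  then show ?case by (simp add: continuous_on_eq_continuous_within)
next
  case (Suc k)
  define D where "D i x = deriv (\<lambda>t. f (x(i := t))) (x i)" for i x
  have D: "((\<lambda>t. f (x(i := t))) has_real_derivative D i x) (at (x i)) \<and>
      (\<exists>S'. openin (Euclidean_space m) S' \<and> x \<in> S' \<and> S' \<subseteq> S \<and> Ck_on k m S' (D i))"
    if i: "i < m" and x: "x \<in> S" for i x
  proof -
    obtain S' D' where S': "openin (Euclidean_space m) S'" "x \<in> S'" "S' \<subseteq> S"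
      and D': "\<And>x. x \<in> S' \<Longrightarrow> ((\<lambda>t. f (x(i := t))) has_real_derivative D' i x) (at (x i))"
        "Ck_on k m S' (D' i)"
      using Suc.prems[OF x] i Ck_on_SucE by metis
    have eq: "D' i x = D i x" if "x \<in> S'" for x
      using D'(1)[OF that] by (simp add: D_def DERIV_imp_deriv)
    have "Ck_on k m S' (D i)"
      by (rule Ck_on_cong[OF S'(1) D'(2) eq])
    moreover have "((\<lambda>t. f (x(i := t))) has_real_derivative D i x) (at (x i))"
      using D'(1)[OF S'(2)] eq[OF S'(2)] by simp
    ultimately show ?thesis using S' by blast
  qed
  \<comment> \<open>Only the continuity of \<open>f\<close> on \<open>S\<close> is extracted from
    this. The induction hypothesis applies to \<open>f\<close> itself once the order on each
    neighbourhood is lowered by one.\<close>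
  have "Ck_on k m S f"
  proof (rule Suc.IH)
    fix x assume x: "x \<in> S"
    obtain S' where "openin (Euclidean_space m) S'" "x \<in> S'" "S' \<subseteq> S" and f: "Ck_on (Suc k) m S' f"
      using Suc.prems[OF x] by (elim exE conjE)
    then show "\<exists>S'. openin (Euclidean_space m) S' \<and> x \<in> S' \<and> S' \<subseteq> S \<and> Ck_on k m S' f"
      using Ck_on_Suc_imp[OF f] by (intro exI[of _ S'] conjI)
  qed
  then have "continuous_on S f" by (rule Ck_on_imp_continuous_on)
  then show ?case
    by (rule Ck_on_SucI) (use D in \<open>auto intro!: Suc.IH\<close>)
qed

section \<open>Constants, coordinates, sums and products\<close>

lemma Ck_on_const: "Ck_on k m S (\<lambda>x. c)"
proof (induction k arbitrary: c)
  case (Suc k)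
  then show ?case by (auto intro!: exI[of _ "\<lambda>i x. 0"])
qed auto

text \<open>A function of one coordinate has vanishing partial derivatives in all other directions.
  If the derivative of \<open>h\<close> is a polynomial in \<open>h\<close>, this becomes the step
  of an induction on the order.\<close>

lemma Ck_on_Suc_coord:
  assumes "\<And>x. x \<in> S \<Longrightarrow> (h has_real_derivative q (x j)) (at (x j))"
    and "Ck_on k m S (\<lambda>x. q (x j))"
  shows "Ck_on (Suc k) m S (\<lambda>x. h (x j))"
proof -
  have "continuous_on ((\<lambda>x. x j) ` S) h"
    by (intro DERIV_atLeastAtMost_imp_continuous_on continuous_at_imp_continuous_on)
       (use assms(1) DERIV_isCont in blast)
  then have "continuous_on S (\<lambda>x. h (x j))"
    by (rule continuous_on_compose2[where g=h]) (auto intro: continuous_on_subset[OF continuous_on_product_coordinates subset_UNIV])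
  moreover have "((\<lambda>t. h ((x(i := t)) j)) has_real_derivative (if i = j then q (x j) else 0)) (at (x i))"
    if "x \<in> S" for i x
    using assms(1)[OF that] by auto
  moreover have "Ck_on k m S (\<lambda>x. if i = j then q (x j) else 0)" for i
    using assms(2) by (cases "i = j") (auto simp: Ck_on_const)
  ultimately show ?thesis by (auto intro!: exI[of _ "\<lambda>i x. if i = j then q (x j) else 0"])
qed

lemma Ck_on_coord: "Ck_on k m S (\<lambda>x. x j)"
proof (cases k)
  case 0
  then show ?thesis by (auto intro: continuous_on_subset[OF continuous_on_product_coordinates subset_UNIV])
next
  case (Suc k')
  then show ?thesis
    using Ck_on_Suc_coord[where h="\<lambda>x. x" and q="\<lambda>x. 1"] Ck_on_const DERIV_ident by blast
qed

lemma Ck_on_add: "Ck_on k m S f \<Longrightarrow> Ck_on k m S g \<Longrightarrow> Ck_on k m S (\<lambda>x. f x + g x)"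
proof (induction k arbitrary: f g)
  case 0
  then show ?case by (auto intro: continuous_on_add)
next
  case (Suc k)
  then obtain D D' where "\<forall>i<m. (\<forall>x\<in>S. ((\<lambda>t. f (x(i := t))) has_real_derivative D i x) (at (x i))) \<and> Ck_on k m S (D i)"
    "\<forall>i<m. (\<forall>x\<in>S. ((\<lambda>t. g (x(i := t))) has_real_derivative D' i x) (at (x i))) \<and> Ck_on k m S (D' i)"
    by auto
  then show ?case using Suc
    by (auto intro!: exI[of _ "\<lambda>i x. D i x + D' i x"] continuous_on_add DERIV_add)
qed

lemma Ck_on_mult: "Ck_on k m S f \<Longrightarrow> Ck_on k m S g \<Longrightarrow> Ck_on k m S (\<lambda>x. f x * g x)"
proof (induction k arbitrary: f g)
  case 0
  then show ?case by (auto intro: continuous_on_mult)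
next
  case (Suc k)
  then obtain D D' where D: "\<forall>i<m. (\<forall>x\<in>S. ((\<lambda>t. f (x(i := t))) has_real_derivative D i x) (at (x i))) \<and> Ck_on k m S (D i)"
    "\<forall>i<m. (\<forall>x\<in>S. ((\<lambda>t. g (x(i := t))) has_real_derivative D' i x) (at (x i))) \<and> Ck_on k m S (D' i)"
    by auto
  let ?D = "\<lambda>i x. D i x * g x + D' i x * f x"
  have "((\<lambda>t. f (x(i := t)) * g (x(i := t))) has_real_derivative ?D i x) (at (x i))"
    if "i < m" "x \<in> S" for i x
    using DERIV_mult[of "\<lambda>t. f (x(i := t))" "D i x" "x i" UNIV "\<lambda>t. g (x(i := t))" "D' i x"] D that
    by simp
  \<comment> \<open>By the Leibniz rule each partial derivative is multiplied by an undifferentiated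
    factor. The derivatives have order \<open>k\<close> only, so the factors are weakened to order
    \<open>k\<close> before the induction hypothesis applies.\<close>
  moreover have "Ck_on k m S (?D i)" if "i < m" for i
    using D that Suc.prems[THEN Ck_on_Suc_imp] by (intro Ck_on_add Suc.IH[of "_ i"]) auto
  ultimately show ?case
    using Suc.prems by (auto intro!: exI[of _ ?D] continuous_on_mult)
qed

lemma Ck_on_sum:
  "(\<And>j. j \<in> J \<Longrightarrow> Ck_on k m S (f j)) \<Longrightarrow> Ck_on k m S (\<lambda>x. \<Sum>j\<in>J. f j x)"
  by (induction J rule: infinite_finite_induct) (auto simp: Ck_on_const Ck_on_add)

section \<open>The chain rule from continuous partial derivatives\<close>

text \<open>Treats \<open>a < b\<close>, \<open>b < a\<close> and \<open>a = b\<close> uniformly,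
  since a coordinate of a curve may move in either direction or stay. When \<open>a = b\<close> both
  sides of the equation are 0.\<close>

lemma mean_value_abs:
  fixes h :: "real \<Rightarrow> real"
  assumes "\<And>s. \<bar>s - a\<bar> \<le> \<bar>b - a\<bar> \<Longrightarrow> (h has_real_derivative h' s) (at s)"
  obtains s where "\<bar>s - a\<bar> \<le> \<bar>b - a\<bar>" "h b - h a = h' s * (b - a)"
proof -
  consider "a < b" | "a = b" | "b < a" by linarith
  then have "\<exists>s. \<bar>s - a\<bar> \<le> \<bar>b - a\<bar> \<and> h b - h a = h' s * (b - a)"
  proof cases
    case 1
    then obtain z where "a < z" "z < b" "h b - h a = (b - a) * h' z"
      using MVT2[of a b h h'] assms by force
    then show ?thesis by (intro exI[of _ z]) auto
  next
    case 2
    then show ?thesis by auto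
  next
    case 3
    then obtain z where "b < z" "z < a" "h a - h b = (a - b) * h' z"
      using MVT2[of b a h h'] assms by force
    then show ?thesis by (intro exI[of _ z]) (auto simp: algebra_simps)
  qed
  then show ?thesis using that by blast
qed

text \<open>
  The point moves from \<open>c t0\<close> to \<open>c t\<close> by changing one coordinate at a time; each step is estimated
  with the mean value theorem in that coordinate.
\<close>

lemma has_real_derivative_chain_partials:
  fixes c :: "real \<Rightarrow> nat \<Rightarrow> real"
  assumes T: "openin (Euclidean_space n) T" "c t0 \<in> T" "\<forall>\<^sub>F t in nhds t0. c t \<in> E n"
    and g: "\<And>j y. j < n \<Longrightarrow> y \<in> T \<Longrightarrow> ((\<lambda>t. g (y(j := t))) has_real_derivative D j y) (at (y j))"
    and D: "\<And>j. j < n \<Longrightarrow> continuous_on T (D j)"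
    and c: "\<And>j. j < n \<Longrightarrow> ((\<lambda>t. c t j) has_real_derivative c' j) (at t0)"
  shows "((\<lambda>t. g (c t)) has_real_derivative (\<Sum>j<n. D j (c t0) * c' j)) (at t0)"
proof -
  define y where "y = c t0"
  \<comment> \<open>\<open>z j t\<close> has already moved its coordinates below \<open>j\<close>:
    \<open>z 0 t\<close> is the start \<open>y\<close>, and \<open>z n t\<close> is
    \<open>c t\<close> as long as \<open>c t\<close> lies in \<open>E n\<close>.\<close>
  define z where "z j t = (\<lambda>i. if i < j then c t i else y i)" for j t
  have y: "y \<in> T" "y \<in> E n" using T openin_subset by (auto simp: y_def)
  have near: "\<forall>\<^sub>F t in nhds t0. \<forall>i<n. \<bar>c t i - y i\<bar> < r" if "r > 0" for r
  proof -
    have "\<forall>\<^sub>F t in nhds t0. \<bar>c t i - y i\<bar> < r" if "i < n" for i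
    proof -
      have "isCont (\<lambda>t. c t i) t0" using c[OF that] DERIV_isCont by blast
      then have "((\<lambda>t. c t i) \<longlongrightarrow> y i) (nhds t0)"
        by (simp add: continuous_at tendsto_at_iff_tendsto_nhds[of "\<lambda>t. c t i"] y_def)
      then show ?thesis using \<open>r > 0\<close> tendstoD by (fastforce simp: dist_real_def)
    qed
    then have "\<forall>\<^sub>F t in nhds t0. \<forall>i\<in>{..<n}. \<bar>c t i - y i\<bar> < r"
      by (intro eventually_ball_finite) auto
    then show ?thesis by eventually_elim simp
  qed
  have part: "((\<lambda>t. g (z (Suc j) t) - g (z j t)) has_real_derivative D j y * c' j) (at t0)"
    if j: "j < n" for j
  proof -
    obtain r where r: "r > 0" "\<And>z. z \<in> E n \<Longrightarrow> (\<And>i. i < n \<Longrightarrow> \<bar>z i - y i\<bar> < r) \<Longrightarrow> z \<in> T"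
      by (rule openin_Euclidean_space_contains_box[OF T(1) y(1)]) blast
    have zE: "(z j t)(j := s) \<in> E n" for s t
      using y j by (auto simp: z_def in_E_iff)
    have zT: "(z j t)(j := s) \<in> T"
      if "\<And>i. i < n \<Longrightarrow> \<bar>c t i - y i\<bar> < r" "\<bar>s - y j\<bar> \<le> \<bar>c t j - y j\<bar>" for s t
      using that j r(1) by (intro r(2) zE) (auto simp: z_def intro: order.strict_trans1)
    have seg: "\<exists>s. \<bar>s - y j\<bar> \<le> \<bar>c t j - y j\<bar> \<and>
        g (z (Suc j) t) - g (z j t) = D j ((z j t)(j := s)) * (c t j - y j)"
      if t: "\<And>i. i < n \<Longrightarrow> \<bar>c t i - y i\<bar> < r" for t
    proof -
      have "((\<lambda>s. g ((z j t)(j := s))) has_real_derivative D j ((z j t)(j := s))) (at s)"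
        if "\<bar>s - y j\<bar> \<le> \<bar>c t j - y j\<bar>" for s
        using g[OF j zT[OF t that]] by simp
      from mean_value_abs[of "y j" "c t j", OF this]
      obtain s where s: "\<bar>s - y j\<bar> \<le> \<bar>c t j - y j\<bar>"
        "g ((z j t)(j := c t j)) - g ((z j t)(j := y j)) = D j ((z j t)(j := s)) * (c t j - y j)"
        by blast
      moreover have "(z j t)(j := c t j) = z (Suc j) t" "(z j t)(j := y j) = z j t"
        by (auto simp: z_def fun_eq_iff less_Suc_eq)
      ultimately show ?thesis by auto
    qed
    \<comment> \<open>\<open>seg\<close> provides a mean value point only while \<open>c t\<close>
      is near \<open>y\<close>. \<open>SOME\<close> turns it into a function \<open>s\<close>, about
      which nothing is claimed for other \<open>t\<close>.\<close>
    define Q where "Q t s \<longleftrightarrow> \<bar>s - y j\<bar> \<le> \<bar>c t j - y j\<bar> \<and>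
        g (z (Suc j) t) - g (z j t) = D j ((z j t)(j := s)) * (c t j - y j)" for t s
    define s where "s t = (SOME s. Q t s)" for t
    have s: "\<bar>s t - y j\<bar> \<le> \<bar>c t j - y j\<bar> \<and>
        g (z (Suc j) t) - g (z j t) = D j ((z j t)(j := s t)) * (c t j - y j)"
      if "\<forall>i<n. \<bar>c t i - y i\<bar> < r" for t
    proof -
      have "\<exists>s. Q t s"
        unfolding Q_def using that by (intro seg) simp
      then show ?thesis
        unfolding s_def Q_def[symmetric] by (rule someI_ex)
    qed
    \<comment> \<open>The mean value point \<open>s t\<close> is at least as close to
      \<open>y j\<close> as \<open>c t j\<close> is, so the point at which \<open>D j\<close> is
      evaluated tends to \<open>y\<close>. Here continuity of the partial derivative enters.\<close>
    have "((\<lambda>t. D j ((z j t)(j := s t))) \<longlongrightarrow> D j y) (at t0)"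
    proof (rule tendstoI)
      fix e :: real assume "e > 0"
      define O' where "O' = T \<inter> D j -` ball (D j y) e"
      have "openin (top_of_set T) O'"
        unfolding O'_def using D[OF j] by (intro continuous_openin_preimage_gen) auto
      then have "openin (Euclidean_space n) O'"
        using T(1) openin_trans by (metis Euclidean_space_top_of_set)
      moreover have "y \<in> O'" using y \<open>e > 0\<close> by (simp add: O'_def)
      ultimately obtain r' where r': "r' > 0"
        "\<And>z. z \<in> E n \<Longrightarrow> (\<And>i. i < n \<Longrightarrow> \<bar>z i - y i\<bar> < r') \<Longrightarrow> z \<in> O'"
        by (rule openin_Euclidean_space_contains_box[of n O' y]) blast
      have "\<forall>\<^sub>F t in nhds t0. dist (D j ((z j t)(j := s t))) (D j y) < e"
        using near[OF r(1)] near[OF r'(1)]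
      proof eventually_elim
        case (elim t)
        then have "\<bar>s t - y j\<bar> < r'" using s[of t] j by force
        then have "(z j t)(j := s t) \<in> O'"
          using elim r'(1) by (intro r'(2) zE) (auto simp: z_def)
        then show ?case by (simp add: O'_def dist_commute)
      qed
      then show "\<forall>\<^sub>F t in at t0. dist (D j ((z j t)(j := s t))) (D j y) < e"
        by (simp add: eventually_at_filter eventually_mono)
    qed
    moreover have "((\<lambda>t. (c t j - y j) / (t - t0)) \<longlongrightarrow> c' j) (at t0)"
      using c[OF j] by (simp add: has_field_derivative_iff y_def)
    ultimately have "((\<lambda>t. D j ((z j t)(j := s t)) * ((c t j - y j) / (t - t0))) \<longlongrightarrow> D j y * c' j) (at t0)"
      by (rule tendsto_mult)
    moreover have "\<forall>\<^sub>F t in nhds t0. D j ((z j t)(j := s t)) * ((c t j - y j) / (t - t0)) =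
        (g (z (Suc j) t) - g (z j t)) / (t - t0)"
      using near[OF r(1)] by eventually_elim (use s in simp)
    then have "\<forall>\<^sub>F t in at t0. D j ((z j t)(j := s t)) * ((c t j - y j) / (t - t0)) =
        (g (z (Suc j) t) - g (z j t)) / (t - t0)"
      unfolding eventually_at_filter by (rule eventually_mono) blast
    ultimately have "((\<lambda>t. (g (z (Suc j) t) - g (z j t)) / (t - t0)) \<longlongrightarrow> D j y * c' j) (at t0)"
      by (rule Lim_transform_eventually)
    moreover have "z (Suc j) t0 = y" "z j t0 = y"
      by (auto simp: z_def y_def)
    ultimately show ?thesis by (simp add: has_field_derivative_iff)
  qed
  \<comment> \<open>The increments \<open>g (z (Suc j) t) - g (z j t)\<close> telescope, starting
    from \<open>g (z 0 t)\<close>, which does not depend on \<open>t\<close>.\<close>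
  have "((\<lambda>t. g (z j t)) has_real_derivative (\<Sum>l<j. D l y * c' l)) (at t0)" if "j \<le> n" for j
    using that
  proof (induction j)
    case 0
    then show ?case by (simp add: z_def)
  next
    case (Suc j)
    then show ?case using DERIV_add[OF Suc.IH part[of j]] by simp
  qed
  then have "((\<lambda>t. g (z n t)) has_real_derivative (\<Sum>l<n. D l y * c' l)) (at t0)"
    by blast
  moreover have ev: "\<forall>\<^sub>F t in nhds t0. g (z n t) = g (c t)"
    using T(3)
  proof eventually_elim
    case (elim t)
    then have "z n t = c t" using y by (auto simp: z_def in_E_iff)
    then show ?case by simp
  qed
  ultimately have "((\<lambda>t. g (c t)) has_real_derivative (\<Sum>l<n. D l y * c' l)) (at t0)"
    using DERIV_cong_ev[OF refl ev refl, THEN iffD1] by blast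
  then show ?thesis unfolding y_def .
qed

text \<open>The partial derivatives of the composite are sums of products
  \<open>D j (f x) * F j i x\<close>. In the induction hypothesis the \<open>D j\<close>, of order
  \<open>k\<close>, take the place of \<open>g\<close>; the induction is therefore general in
  \<open>g\<close>.\<close>

lemma Ck_on_compose:
  assumes S: "openin (Euclidean_space m) S" and T: "openin (Euclidean_space n) T"
    and f: "f ` S \<subseteq> T" "\<And>j. j < n \<Longrightarrow> Ck_on k m S (\<lambda>x. f x j)"
    and g: "Ck_on k n T g"
  shows "Ck_on k m S (\<lambda>x. g (f x))"
  using f(2) g
proof (induction k arbitrary: g)
  case 0
  \<comment> \<open>Continuity into the product topology concerns all coordinates. Those from
    \<open>n\<close> on vanish identically, because \<open>T\<close> lies in
    \<open>E n\<close>.\<close>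
  have "continuous_on S (\<lambda>x. f x j)" for j
  proof (cases "j < n")
    case True
    then show ?thesis using 0 by simp
  next
    case False
    then have "f x j = 0" if "x \<in> S" for x
      using f(1) that openin_subset[OF T] by (fastforce simp: in_E_iff)
    then show ?thesis by (simp cong: continuous_on_cong)
  qed
  then have "continuous_on S f"
    by (rule continuous_on_coordinatewise_then_product)
  then show ?case using 0(2) f(1) continuous_on_compose2[of T g S f] by simp
next
  case (Suc k)
  obtain D where D: "\<And>j y. j < n \<Longrightarrow> y \<in> T \<Longrightarrow> ((\<lambda>t. g (y(j := t))) has_real_derivative D j y) (at (y j))"
      "\<And>j. j < n \<Longrightarrow> Ck_on k n T (D j)"
    using Suc.prems(2) by auto
  have "\<forall>j<n. \<exists>F. \<forall>i<m. (\<forall>x\<in>S. ((\<lambda>t. f (x(i := t)) j) has_real_derivative F i x) (at (x i))) \<and> Ck_on k m S (F i)"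
    using Suc.prems(1) by simp
  then obtain F where F: "\<And>i j x. j < n \<Longrightarrow> i < m \<Longrightarrow> x \<in> S \<Longrightarrow>
      ((\<lambda>t. f (x(i := t)) j) has_real_derivative F j i x) (at (x i))"
      "\<And>i j. j < n \<Longrightarrow> i < m \<Longrightarrow> Ck_on k m S (F j i)"
    by metis
  have f': "Ck_on k m S (\<lambda>x. f x j)" if "j < n" for j
    using Suc.prems(1)[OF that] by (rule Ck_on_Suc_imp)
  let ?D = "\<lambda>i x. \<Sum>j<n. D j (f x) * F j i x"
  have "((\<lambda>t. g (f (x(i := t)))) has_real_derivative ?D i x) (at (x i))" if "i < m" "x \<in> S" for i x
  proof -
    have "\<forall>\<^sub>F t in nhds (x i). f (x(i := t)) \<in> E n"
      using eventually_fun_upd_in[OF S that(2,1)]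
      by eventually_elim (use f(1) openin_subset[OF T] in blast)
    \<comment> \<open>The curve is \<open>f (x(i := t))\<close>; its base point is kept in the form
      \<open>x(i := x i)\<close> so that it matches \<open>c t0\<close> in the chain rule.\<close>
    moreover have "f (x(i := x i)) \<in> T"
      using f(1) that by auto
    ultimately have "((\<lambda>t. g (f (x(i := t)))) has_real_derivative
        (\<Sum>j<n. D j (f (x(i := x i))) * F j i x)) (at (x i))"
      using has_real_derivative_chain_partials[OF T, of "\<lambda>t. f (x(i := t))" "x i" g D "\<lambda>j. F j i x"]
        D(1) Ck_on_imp_continuous_on[OF D(2)] F(1)[OF _ that] by blast
    then show ?thesis by (simp only: fun_upd_triv)
  qed
  moreover have "Ck_on k m S (?D i)" if "i < m" for i
  proof (rule Ck_on_sum)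
    fix j assume "j \<in> {..<n}"
    then have j: "j < n" by simp
    show "Ck_on k m S (\<lambda>x. D j (f x) * F j i x)"
      by (rule Ck_on_mult[OF Suc.IH[OF f' D(2)[OF j]] F(2)[OF j that]])
  qed
  moreover have "continuous_on S (\<lambda>x. g (f x))"
    using Ck_on_imp_continuous_on[OF Suc.IH[OF f' Ck_on_Suc_imp[OF Suc.prems(2)]]] .
  ultimately show ?case by (intro Ck_on_SucI[of _ _ _ ?D])
qed

subsection \<open>Smooth maps\<close>

lemma smooth_on_cong:
  assumes "openin (Euclidean_space m) S" "smooth_on m n S f" "\<And>x. x \<in> S \<Longrightarrow> f x = g x"
  shows "smooth_on m n S g"
proof -
  have "g ` S \<subseteq> E n"
    using assms(2) image_cong[OF refl assms(3), of S] by (simp add: smooth_on_def)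
  moreover have "Ck_on k m S (\<lambda>x. g x j)" if "j < n" for j k
    by (rule Ck_on_cong[OF assms(1), of k "\<lambda>x. f x j"])
      (use assms(2,3) that in \<open>simp_all add: smooth_on_def\<close>)
  ultimately show ?thesis by (simp add: smooth_on_def)
qed

lemma smooth_on_subset: "smooth_on m n S f \<Longrightarrow> S' \<subseteq> S \<Longrightarrow> smooth_on m n S' f"
  by (auto simp: smooth_on_def intro: Ck_on_subset[of _ m S _ S'])

lemma smooth_on_local:
  assumes "openin (Euclidean_space m) S"
    and "\<And>x. x \<in> S \<Longrightarrow> \<exists>S'. openin (Euclidean_space m) S' \<and> x \<in> S' \<and> S' \<subseteq> S \<and> smooth_on m n S' f"
  shows "smooth_on m n S f"
proof -
  have "f x \<in> E n" if "x \<in> S" for x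
    using assms(2)[OF that] unfolding smooth_on_def by (elim exE conjE) blast
  moreover have "Ck_on k m S (\<lambda>x. f x j)" if j: "j < n" for j k
  proof (rule Ck_on_local[OF assms(1)])
    fix x assume "x \<in> S"
    then obtain S' where "openin (Euclidean_space m) S'" "x \<in> S'" "S' \<subseteq> S" "smooth_on m n S' f"
      using assms(2) by meson
    moreover from this(4) have "Ck_on k m S' (\<lambda>x. f x j)"
      using j by (simp add: smooth_on_def)
    ultimately show "\<exists>S'. openin (Euclidean_space m) S' \<and> x \<in> S' \<and> S' \<subseteq> S \<and> Ck_on k m S' (\<lambda>x. f x j)"
      by blast
  qed
  ultimately show ?thesis by (simp add: smooth_on_def image_subset_iff)
qed

lemma smooth_on_compose:
  assumes "openin (Euclidean_space m) S" "openin (Euclidean_space n) T" "f ` S \<subseteq> T"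
    and "smooth_on m n S f" "smooth_on n l T g"
  shows "smooth_on m l S (g \<circ> f)"
proof -
  have "(g \<circ> f) ` S \<subseteq> E l"
    using assms(3,5) by (auto simp: smooth_on_def image_subset_iff)
  moreover have "Ck_on k m S (\<lambda>x. (g \<circ> f) x j)" if "j < l" for j k
    using Ck_on_compose[OF assms(1-3), of k "\<lambda>y. g y j"] assms(4,5) that
    by (simp add: smooth_on_def)
  ultimately show ?thesis by (simp add: smooth_on_def)
qed

lemma smooth_on_id: "S \<subseteq> E m \<Longrightarrow> smooth_on m m S (\<lambda>x. x)"
  by (auto simp: smooth_on_def Ck_on_coord)

lemma smooth_on_const: "c \<in> E n \<Longrightarrow> smooth_on m n S (\<lambda>x. c)"
  by (auto simp: smooth_on_def Ck_on_const)

lemma smooth_on_imp_continuous_on: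
  assumes "smooth_on m n S f"
  shows "continuous_on S f"
proof (rule continuous_on_coordinatewise_then_product)
  fix j
  show "continuous_on S (\<lambda>x. f x j)"
  proof (cases "j < n")
    case True
    then have "Ck_on 0 m S (\<lambda>x. f x j)" using assms unfolding smooth_on_def by blast
    then show ?thesis by simp
  next
    case False
    then have "f x j = 0" if "x \<in> S" for x
      using assms that by (fastforce simp: smooth_on_def in_E_iff)
    then show ?thesis by (simp cong: continuous_on_cong)
  qed
qed

lemma openin_smooth_on_vimage:
  assumes "smooth_on m n S f" "openin (Euclidean_space m) S" "openin (Euclidean_space n) A"
  shows "openin (Euclidean_space m) (S \<inter> f -` A)"
proof -
  obtain A' where A': "open A'" "A = E n \<inter> A'"
    using assms(3) by (auto simp: openin_Euclidean_space)
  have "S \<inter> f -` A = S \<inter> f -` A'"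
    using assms(1) A' by (auto simp: smooth_on_def)
  then have "openin (top_of_set S) (S \<inter> f -` A)"
    using continuous_openin_preimage_gen[OF smooth_on_imp_continuous_on[OF assms(1)] A'(1)] by simp
  then show ?thesis
    using assms(2) openin_trans by (metis Euclidean_space_top_of_set)
qed

subsection \<open>Charts\<close>

text \<open>Replaces the homeomorphism between subspaces by images and preimages of open sets of the
  ambient spaces. This works because domain and image of a chart are open, so that relatively open
  subsets are open.\<close>

lemma is_chart_iff:
  "is_chart T n (U, \<phi>) \<longleftrightarrow> openin T U \<and> \<phi> \<in> extensional U \<and> inj_on \<phi> U \<and>
     (\<forall>A. openin T A \<and> A \<subseteq> U \<longrightarrow> openin (Euclidean_space n) (\<phi> ` A)) \<and>
     (\<forall>B. openin (Euclidean_space n) B \<longrightarrow> openin T (U \<inter> \<phi> -` B))"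
  (is "?L \<longleftrightarrow> ?R")
proof
  assume ?L
  then have U: "openin T U" "\<phi> \<in> extensional U" "openin (Euclidean_space n) (\<phi> ` U)"
    and h: "homeomorphic_map (subtopology T U) (subtopology (Euclidean_space n) (\<phi> ` U)) \<phi>"
    by (auto simp: is_chart_def)
  have tU: "topspace (subtopology T U) = U"
    using openin_subset[OF U(1)] by auto
  have "openin (Euclidean_space n) (\<phi> ` A)" if "openin T A" "A \<subseteq> U" for A
  proof -
    have "openin (subtopology T U) A"
      using that U(1) by (simp add: openin_open_subtopology)
    then have "openin (subtopology (Euclidean_space n) (\<phi> ` U)) (\<phi> ` A)"
      using homeomorphic_imp_open_map[OF h] by (simp add: open_map_def)
    then show ?thesis using U(3) openin_trans_full by blast
  qed
  moreover have "openin T (U \<inter> \<phi> -` B)" if "openin (Euclidean_space n) B" for B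
  proof -
    have "openin (subtopology (Euclidean_space n) (\<phi> ` U)) (\<phi> ` U \<inter> B)"
      using that by (simp add: openin_subtopology_Int2)
    then have "openin (subtopology T U) {x \<in> topspace (subtopology T U). \<phi> x \<in> \<phi> ` U \<inter> B}"
      using homeomorphic_imp_continuous_map[OF h] openin_continuous_map_preimage by blast
    moreover have "{x \<in> topspace (subtopology T U). \<phi> x \<in> \<phi> ` U \<inter> B} = U \<inter> \<phi> -` B"
      unfolding tU by auto
    ultimately show ?thesis using U(1) openin_trans_full by metis
  qed
  moreover have "inj_on \<phi> U"
    using homeomorphic_imp_injective_map[OF h] tU by simp
  ultimately show ?R using U by blast
next
  assume R: ?R
  then have U: "openin T U" and oU: "openin (Euclidean_space n) (\<phi> ` U)" by auto
  have tU: "topspace (subtopology T U) = U"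
    using openin_subset[OF U] by auto
  have tE: "topspace (subtopology (Euclidean_space n) (\<phi> ` U)) = \<phi> ` U"
    using openin_subset[OF oU] by auto
  have "homeomorphic_map (subtopology T U) (subtopology (Euclidean_space n) (\<phi> ` U)) \<phi>"
  proof (rule bijective_open_imp_homeomorphic_map)
    show "continuous_map (subtopology T U) (subtopology (Euclidean_space n) (\<phi> ` U)) \<phi>"
      unfolding continuous_map_def tU tE
    proof (intro conjI allI impI)
      fix B assume "openin (subtopology (Euclidean_space n) (\<phi> ` U)) B"
      then have "openin T (U \<inter> \<phi> -` B)"
        using R oU openin_trans_full by metis
      moreover have "{x \<in> U. \<phi> x \<in> B} = U \<inter> \<phi> -` B" by auto
      ultimately show "openin (subtopology T U) {x \<in> U. \<phi> x \<in> B}"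
        using U by (simp add: openin_open_subtopology)
    qed auto
    show "open_map (subtopology T U) (subtopology (Euclidean_space n) (\<phi> ` U)) \<phi>"
      unfolding open_map_def using R U oU by (auto simp: openin_open_subtopology)
  qed (use R tU tE in auto)
  then show ?L using R oU by (simp add: is_chart_def)
qed

lemma is_chart_restrict:
  assumes "is_chart T n (U, \<phi>)" "openin T W"
  shows "is_chart T n (U \<inter> W, restrict \<phi> (U \<inter> W))"
proof -
  have "openin T (U \<inter> W \<inter> restrict \<phi> (U \<inter> W) -` B)" if "openin (Euclidean_space n) B" for B
  proof -
    have "U \<inter> W \<inter> restrict \<phi> (U \<inter> W) -` B = (U \<inter> \<phi> -` B) \<inter> W" by auto
    then show ?thesis using assms that by (auto simp: is_chart_iff)
  qed
  moreover have "openin (Euclidean_space n) (restrict \<phi> (U \<inter> W) ` A)" if "openin T A" "A \<subseteq> U \<inter> W" for A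
  proof -
    have "restrict \<phi> (U \<inter> W) ` A = \<phi> ` A" using that(2) by auto
    then show ?thesis using assms that by (auto simp: is_chart_iff)
  qed
  ultimately show ?thesis using assms by (auto simp: is_chart_iff inj_on_def)
qed

lemma is_chart_subtopology:
  assumes "openin T W"
  shows "is_chart (subtopology T W) n (U, \<phi>) \<longleftrightarrow> is_chart T n (U, \<phi>) \<and> U \<subseteq> W"
proof (cases "U \<subseteq> W")
  case True
  then have "(openin T A \<and> A \<subseteq> W) \<and> A \<subseteq> U \<longleftrightarrow> openin T A \<and> A \<subseteq> U" "U \<inter> \<phi> -` B \<subseteq> W" for A B
    by auto
  then show ?thesis
    using True by (simp add: is_chart_iff openin_open_subtopology[OF assms])
qed (simp add: is_chart_iff openin_open_subtopology[OF assms])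

text \<open>One half of \<open>compatible\<close>. Compatibility is symmetric, so an argument about
  one direction can be applied twice.\<close>

definition smooth_transition :: "nat \<Rightarrow> 'm chart \<Rightarrow> 'm chart \<Rightarrow> bool" where
  "smooth_transition n = (\<lambda>(U, \<phi>) (V, \<psi>). smooth_on n n (\<phi> ` (U \<inter> V)) (\<psi> \<circ> inv_into U \<phi>))"

lemma compatible_iff:
  "compatible n c d \<longleftrightarrow> smooth_transition n c d \<and> smooth_transition n d c"
  by (cases c; cases d) (simp add: compatible_def smooth_transition_def Int_commute)

text \<open>\<open>g\<close> after the inverse of \<open>\<psi>\<close> is \<open>g\<close> after
  the inverse of \<open>\<phi>\<close>, preceded by the transition from \<open>V\<close> to
  \<open>U\<close>. As \<open>g\<close> is arbitrary, it can be a further chart or a map into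
  another manifold followed by a chart there.\<close>

lemma smooth_on_change_chart:
  assumes U: "is_chart T n (U, \<phi>)" and V: "is_chart T n (V, \<psi>)"
    and tr: "smooth_transition n (V, \<psi>) (U, \<phi>)"
    and A: "openin T A" "A \<subseteq> U" "A \<subseteq> V"
    and g: "smooth_on n m (\<phi> ` A) (g \<circ> inv_into U \<phi>)"
  shows "smooth_on n m (\<psi> ` A) (g \<circ> inv_into V \<psi>)"
proof -
  have oV: "openin (Euclidean_space n) (\<psi> ` A)" and oU: "openin (Euclidean_space n) (\<phi> ` A)"
    using U V A by (auto simp: is_chart_iff)
  have inj: "inj_on \<phi> U" "inj_on \<psi> V"
    using U V by (auto simp: is_chart_iff)
  have "smooth_on n n (\<psi> ` A) (\<phi> \<circ> inv_into V \<psi>)"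
    by (rule smooth_on_subset[of _ _ "\<psi> ` (V \<inter> U)"]) (use tr A in \<open>auto simp: smooth_transition_def\<close>)
  moreover have "(\<phi> \<circ> inv_into V \<psi>) ` \<psi> ` A \<subseteq> \<phi> ` A"
    using A inj by (auto simp: inv_into_f_f subset_iff)
  ultimately have "smooth_on n m (\<psi> ` A) ((g \<circ> inv_into U \<phi>) \<circ> (\<phi> \<circ> inv_into V \<psi>))"
    using smooth_on_compose[OF oV oU _ _ g] by blast
  then show ?thesis
    by (rule smooth_on_cong[OF oV]) (use A inj in \<open>auto simp: inv_into_f_f subset_iff\<close>)
qed

text \<open>Near a point of \<open>U \<inter> V\<close> the transition factors through
  \<open>W\<close>. As \<open>W\<close> may cover only part of the overlap, the factorization is
  local and the pieces are joined by \<open>smooth_on_local\<close>. In this way compatibility with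
  a covering family of charts yields compatibility between two charts.\<close>

lemma smooth_transition_local:
  assumes U: "is_chart T n (U, \<phi>)" and V: "is_chart T n (V, \<psi>)"
    and "\<And>x. x \<in> U \<inter> V \<Longrightarrow> \<exists>W \<theta>. x \<in> W \<and> is_chart T n (W, \<theta>) \<and>
      smooth_transition n (U, \<phi>) (W, \<theta>) \<and> smooth_transition n (W, \<theta>) (V, \<psi>)"
  shows "smooth_transition n (U, \<phi>) (V, \<psi>)"
  unfolding smooth_transition_def prod.case
proof (rule smooth_on_local)
  show "openin (Euclidean_space n) (\<phi> ` (U \<inter> V))"
    using U V by (auto simp: is_chart_iff)
next
  fix y assume "y \<in> \<phi> ` (U \<inter> V)"
  then obtain x where x: "x \<in> U \<inter> V" "y = \<phi> x" by blast
  obtain W \<theta> where W: "x \<in> W" "is_chart T n (W, \<theta>)" "smooth_transition n (U, \<phi>) (W, \<theta>)"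
      "smooth_transition n (W, \<theta>) (V, \<psi>)"
    using assms(3)[OF x(1)] by blast
  let ?A = "U \<inter> V \<inter> W"
  have A: "openin T ?A" using U V W by (auto simp: is_chart_iff)
  have "smooth_on n n (\<theta> ` ?A) (\<psi> \<circ> inv_into W \<theta>)"
    by (rule smooth_on_subset[of _ _ "\<theta> ` (W \<inter> V)"]) (use W(4) in \<open>auto simp: smooth_transition_def\<close>)
  then have "smooth_on n n (\<phi> ` ?A) (\<psi> \<circ> inv_into U \<phi>)"
    by (intro smooth_on_change_chart[OF W(2) U W(3) A]) auto
  moreover have "openin (Euclidean_space n) (\<phi> ` ?A)"
    using U A unfolding is_chart_iff by blast
  ultimately show "\<exists>S'. openin (Euclidean_space n) S' \<and> y \<in> S' \<and> S' \<subseteq> \<phi> ` (U \<inter> V) \<and>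
      smooth_on n n S' (\<psi> \<circ> inv_into U \<phi>)"
    using x W(1) by (intro exI[of _ "\<phi> ` ?A"]) auto
qed

text \<open>On the points concerned, restricting changes neither the values of the chart nor those
  of its inverse. The explicit \<open>restrict\<close> comes from the extensionality demanded of
  charts.\<close>

lemma smooth_transition_restrict:
  assumes U: "is_chart T n (U, \<phi>)" and V: "is_chart T n (V, \<psi>)" and W: "openin T W"
  shows "smooth_transition n (U, \<phi>) (V, \<psi>) \<Longrightarrow>
      smooth_transition n (U \<inter> W, restrict \<phi> (U \<inter> W)) (V, \<psi>)"
    and "smooth_transition n (V, \<psi>) (U, \<phi>) \<Longrightarrow>
      smooth_transition n (V, \<psi>) (U \<inter> W, restrict \<phi> (U \<inter> W))"
proof -
  let ?A = "U \<inter> W \<inter> V"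
  have A: "openin T ?A" using assms by (auto simp: is_chart_iff)
  have o: "openin (Euclidean_space n) (\<phi> ` ?A)" "openin (Euclidean_space n) (\<psi> ` ?A)"
    using U V A unfolding is_chart_iff by blast+
  have inj: "inj_on \<phi> U" "inj_on \<psi> V" "inj_on (restrict \<phi> (U \<inter> W)) (U \<inter> W)"
    using U V by (auto simp: is_chart_iff inj_on_def)
  have inv: "inv_into (U \<inter> W) (restrict \<phi> (U \<inter> W)) (\<phi> x) = x" if "x \<in> U \<inter> W" for x
    using inv_into_f_f[OF inj(3) that] that by simp
  show "smooth_transition n (U \<inter> W, restrict \<phi> (U \<inter> W)) (V, \<psi>)"
    if "smooth_transition n (U, \<phi>) (V, \<psi>)"
  proof -
    have "smooth_on n n (\<phi> ` ?A) (\<psi> \<circ> inv_into U \<phi>)"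
      by (rule smooth_on_subset[of _ _ "\<phi> ` (U \<inter> V)"]) (use that in \<open>auto simp: smooth_transition_def\<close>)
    then have "smooth_on n n (\<phi> ` ?A) (\<psi> \<circ> inv_into (U \<inter> W) (restrict \<phi> (U \<inter> W)))"
      by (rule smooth_on_cong[OF o(1)]) (use inv inj in \<open>auto simp: inv_into_f_f\<close>)
    moreover have "restrict \<phi> (U \<inter> W) ` ?A = \<phi> ` ?A" by auto
    ultimately show ?thesis by (simp add: smooth_transition_def)
  qed
  show "smooth_transition n (V, \<psi>) (U \<inter> W, restrict \<phi> (U \<inter> W))"
    if "smooth_transition n (V, \<psi>) (U, \<phi>)"
  proof -
    have "smooth_on n n (\<psi> ` ?A) (\<phi> \<circ> inv_into V \<psi>)"
      by (rule smooth_on_subset[of _ _ "\<psi> ` (V \<inter> U)"]) (use that in \<open>auto simp: smooth_transition_def\<close>)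
    then have "smooth_on n n (\<psi> ` ?A) (restrict \<phi> (U \<inter> W) \<circ> inv_into V \<psi>)"
      by (rule smooth_on_cong[OF o(2)]) (use inj in \<open>auto simp: inv_into_f_f\<close>)
    moreover have "V \<inter> (U \<inter> W) = ?A" by auto
    ultimately show ?thesis by (simp add: smooth_transition_def)
  qed
qed

subsection \<open>Smooth maps between manifolds\<close>

lemma atlas_is_chart: "smooth_manifold M \<Longrightarrow> c \<in> atlas M \<Longrightarrow> is_chart (mtop M) (mdim M) c"
  by (simp add: smooth_manifold_def)

lemma atlas_compatible:
  "smooth_manifold M \<Longrightarrow> c \<in> atlas M \<Longrightarrow> d \<in> atlas M \<Longrightarrow> compatible (mdim M) c d"
  by (simp add: smooth_manifold_def)

lemma atlas_maximal:
  assumes "smooth_manifold M" "is_chart (mtop M) (mdim M) c"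
    and "\<And>d. d \<in> atlas M \<Longrightarrow> compatible (mdim M) c d"
  shows "c \<in> atlas M"
proof -
  have "is_chart (mtop M) (mdim M) c \<and> (\<forall>d\<in>atlas M. compatible (mdim M) c d) \<longrightarrow> c \<in> atlas M"
    using assms(1) unfolding smooth_manifold_def by blast
  then show ?thesis using assms(2,3) by blast
qed

lemma chart_at:
  assumes "smooth_manifold M" "x \<in> points M"
  obtains U \<phi> where "(U, \<phi>) \<in> atlas M" "x \<in> U" "is_chart (mtop M) (mdim M) (U, \<phi>)"
proof -
  have "x \<in> (\<Union>(U, \<phi>)\<in>atlas M. U)"
    using assms by (simp add: smooth_manifold_def)
  then show ?thesis using that atlas_is_chart[OF assms(1)] by auto
qed

lemma chart_subset_points:
  "smooth_manifold M \<Longrightarrow> (U, \<phi>) \<in> atlas M \<Longrightarrow> U \<subseteq> points M"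
  by (metis atlas_is_chart is_chart_iff openin_subset)

lemma openin_Int_vimage:
  assumes "continuous_map S T f" "openin S A" "openin T B"
  shows "openin S (A \<inter> f -` B)"
proof -
  have "A \<inter> f -` B = A \<inter> {x \<in> topspace S. f x \<in> B}"
    using openin_subset[OF assms(2)] by auto
  then show ?thesis
    using openin_Int[OF assms(2) openin_continuous_map_preimage[OF assms(1,3)]] by simp
qed

text \<open>The definition quantifies over all pairs of charts; here one pair near each point is
  enough. The source chart is exchanged by \<open>smooth_on_change_chart\<close>, the target chart
  by composing with a transition map of \<open>N\<close>.\<close>

lemma smooth_mapI_local:
  assumes M: "smooth_manifold M" and N: "smooth_manifold N"
    and cont: "continuous_map (mtop M) (mtop N) f"
    and loc: "\<And>x. x \<in> points M \<Longrightarrow> \<exists>U \<phi> V \<psi> A. (U, \<phi>) \<in> atlas M \<and> (V, \<psi>) \<in> atlas N \<and>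
      openin (mtop M) A \<and> x \<in> A \<and> A \<subseteq> U \<and> f ` A \<subseteq> V \<and>
      smooth_on (mdim M) (mdim N) (\<phi> ` A) (\<psi> \<circ> f \<circ> inv_into U \<phi>)"
  shows "smooth_map M N f"
  unfolding smooth_map_def
proof (intro conjI cont ballI, safe)
  fix U \<phi> V \<psi> assume c: "(U, \<phi>) \<in> atlas M" "(V, \<psi>) \<in> atlas N"
  note U = atlas_is_chart[OF M c(1)] and V = atlas_is_chart[OF N c(2)]
  have UV: "openin (mtop M) (U \<inter> f -` V)"
    using openin_Int_vimage[OF cont] U V by (auto simp: is_chart_iff)
  show "smooth_on (mdim M) (mdim N) (\<phi> ` (U \<inter> f -` V)) (\<psi> \<circ> f \<circ> inv_into U \<phi>)"
  proof (rule smooth_on_local)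
    show "openin (Euclidean_space (mdim M)) (\<phi> ` (U \<inter> f -` V))"
      using U UV unfolding is_chart_iff by blast
  next
    fix y assume "y \<in> \<phi> ` (U \<inter> f -` V)"
    then obtain x where x: "x \<in> U" "f x \<in> V" "y = \<phi> x" by blast
    have xM: "x \<in> points M" using x chart_subset_points[OF M c(1)] by blast
    obtain U' \<phi>' V' \<psi>' A where c': "(U', \<phi>') \<in> atlas M" "(V', \<psi>') \<in> atlas N" and
      A: "openin (mtop M) A" "x \<in> A" "A \<subseteq> U'" "f ` A \<subseteq> V'" and
      sm: "smooth_on (mdim M) (mdim N) (\<phi>' ` A) (\<psi>' \<circ> f \<circ> inv_into U' \<phi>')"
      using loc[OF xM] by (elim exE conjE) blast
    note U' = atlas_is_chart[OF M c'(1)] and V' = atlas_is_chart[OF N c'(2)]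
    \<comment> \<open>On \<open>B\<close> both source charts are defined, and \<open>f\<close> takes
      its values there in both target charts.\<close>
    define B where "B = A \<inter> (U \<inter> f -` V)"
    have B: "openin (mtop M) B" "B \<subseteq> U" "B \<subseteq> U'" "f ` B \<subseteq> V \<inter> V'" "x \<in> B"
      using A UV x by (auto simp: B_def)
    have oB: "openin (Euclidean_space (mdim M)) (\<phi> ` B)"
      using U B unfolding is_chart_iff by blast
    have oV: "openin (Euclidean_space (mdim N)) (\<psi>' ` (V' \<inter> V))"
      using V' V by (auto simp: is_chart_iff)
    have inj: "inj_on \<phi> U" "inj_on \<psi>' V'"
      using U V' by (auto simp: is_chart_iff)
    have "smooth_on (mdim M) (mdim N) (\<phi>' ` B) (\<psi>' \<circ> f \<circ> inv_into U' \<phi>')"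
      by (rule smooth_on_subset[OF sm]) (auto simp: B_def)
    then have "smooth_on (mdim M) (mdim N) (\<phi> ` B) (\<psi>' \<circ> f \<circ> inv_into U \<phi>)"
      by (intro smooth_on_change_chart[OF U' U _ B(1)])
        (use atlas_compatible[OF M c(1) c'(1)] B in \<open>auto simp: compatible_iff\<close>)
    moreover have "smooth_on (mdim N) (mdim N) (\<psi>' ` (V' \<inter> V)) (\<psi> \<circ> inv_into V' \<psi>')"
      using atlas_compatible[OF N c'(2) c(2)] by (simp add: compatible_iff smooth_transition_def)
    moreover have "(\<psi>' \<circ> f \<circ> inv_into U \<phi>) ` \<phi> ` B \<subseteq> \<psi>' ` (V' \<inter> V)"
      using B inj by (auto simp: inv_into_f_f subset_iff)
    ultimately have "smooth_on (mdim M) (mdim N) (\<phi> ` B)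
        ((\<psi> \<circ> inv_into V' \<psi>') \<circ> (\<psi>' \<circ> f \<circ> inv_into U \<phi>))"
      by (intro smooth_on_compose[OF oB oV])
    then have "smooth_on (mdim M) (mdim N) (\<phi> ` B) (\<psi> \<circ> f \<circ> inv_into U \<phi>)"
      by (rule smooth_on_cong[OF oB]) (use B inj in \<open>auto simp: inv_into_f_f subset_iff\<close>)
    then show "\<exists>S'. openin (Euclidean_space (mdim M)) S' \<and> y \<in> S' \<and> S' \<subseteq> \<phi> ` (U \<inter> f -` V) \<and>
        smooth_on (mdim M) (mdim N) S' (\<psi> \<circ> f \<circ> inv_into U \<phi>)"
      using oB B(5) x(3) by (intro exI[of _ "\<phi> ` B"]) (auto simp: B_def)
  qed
qed

lemma smooth_map_continuous: "smooth_map M N f \<Longrightarrow> continuous_map (mtop M) (mtop N) f"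
  by (simp add: smooth_map_def)

lemma smooth_map_image: "smooth_map M N f \<Longrightarrow> x \<in> points M \<Longrightarrow> f x \<in> points N"
  using funcset_mem[OF continuous_map_funspace[OF smooth_map_continuous]] .

lemma smooth_map_in_charts:
  assumes "smooth_map M N f" "(U, \<phi>) \<in> atlas M" "(V, \<psi>) \<in> atlas N"
  shows "smooth_on (mdim M) (mdim N) (\<phi> ` (U \<inter> f -` V)) (\<psi> \<circ> f \<circ> inv_into U \<phi>)"
  using assms by (auto simp: smooth_map_def)

text \<open>A chart of \<open>M\<close> and one of \<open>K\<close> need not be linked by a single
  chart of \<open>N\<close>. The local criterion is therefore applied on a set \<open>A\<close> that
  \<open>f\<close> sends into the middle chart and \<open>g \<circ> f\<close> into the last
  one.\<close>

lemma smooth_map_compose: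
  assumes M: "smooth_manifold M" and N: "smooth_manifold N" and K: "smooth_manifold K"
    and f: "smooth_map M N f" and g: "smooth_map N K g"
  shows "smooth_map M K (g \<circ> f)"
proof (rule smooth_mapI_local[OF M K])
  show "continuous_map (mtop M) (mtop K) (g \<circ> f)"
    using f g by (auto simp: smooth_map_def intro: continuous_map_compose)
next
  fix x assume x: "x \<in> points M"
  obtain U \<phi> where U: "(U, \<phi>) \<in> atlas M" "x \<in> U" "is_chart (mtop M) (mdim M) (U, \<phi>)"
    using chart_at[OF M x] .
  obtain V \<psi> where V: "(V, \<psi>) \<in> atlas N" "f x \<in> V" "is_chart (mtop N) (mdim N) (V, \<psi>)"
    using chart_at[OF N smooth_map_image[OF f x]] .
  obtain W \<theta> where W: "(W, \<theta>) \<in> atlas K" "g (f x) \<in> W" "is_chart (mtop K) (mdim K) (W, \<theta>)"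
    using chart_at[OF K smooth_map_image[OF g smooth_map_image[OF f x]]] .
  have VW: "openin (mtop N) (V \<inter> g -` W)"
    using openin_Int_vimage[OF smooth_map_continuous[OF g]] V W by (auto simp: is_chart_iff)
  define A where "A = U \<inter> f -` (V \<inter> g -` W)"
  have A: "openin (mtop M) A"
    using openin_Int_vimage[OF smooth_map_continuous[OF f] _ VW] U by (auto simp: is_chart_iff A_def)
  have oA: "openin (Euclidean_space (mdim M)) (\<phi> ` A)"
    using U(3) A unfolding is_chart_iff A_def by blast
  have oV: "openin (Euclidean_space (mdim N)) (\<psi> ` (V \<inter> g -` W))"
    using V(3) VW unfolding is_chart_iff by blast
  have inj: "inj_on \<phi> U" "inj_on \<psi> V"
    using U V by (auto simp: is_chart_iff)
  have "smooth_on (mdim M) (mdim N) (\<phi> ` A) (\<psi> \<circ> f \<circ> inv_into U \<phi>)"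
    by (rule smooth_on_subset[OF smooth_map_in_charts[OF f U(1) V(1)]]) (auto simp: A_def)
  moreover have "(\<psi> \<circ> f \<circ> inv_into U \<phi>) ` \<phi> ` A \<subseteq> \<psi> ` (V \<inter> g -` W)"
    using inj by (auto simp: inv_into_f_f A_def)
  ultimately have "smooth_on (mdim M) (mdim K) (\<phi> ` A) ((\<theta> \<circ> g \<circ> inv_into V \<psi>) \<circ> (\<psi> \<circ> f \<circ> inv_into U \<phi>))"
    using smooth_map_in_charts[OF g V(1) W(1)] by (intro smooth_on_compose[OF oA oV])
  then have "smooth_on (mdim M) (mdim K) (\<phi> ` A) (\<theta> \<circ> (g \<circ> f) \<circ> inv_into U \<phi>)"
    by (rule smooth_on_cong[OF oA]) (use inj in \<open>auto simp: inv_into_f_f A_def\<close>)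
  then show "\<exists>U \<phi> V \<psi> A. (U, \<phi>) \<in> atlas M \<and> (V, \<psi>) \<in> atlas K \<and>
      openin (mtop M) A \<and> x \<in> A \<and> A \<subseteq> U \<and> (g \<circ> f) ` A \<subseteq> V \<and>
      smooth_on (mdim M) (mdim K) (\<phi> ` A) (\<psi> \<circ> (g \<circ> f) \<circ> inv_into U \<phi>)"
    using U W V(2) A by (intro exI[of _ U] exI[of _ \<phi>] exI[of _ W] exI[of _ \<theta>] exI[of _ A])
      (auto simp: A_def)
qed

text \<open>Read in charts, the identity is a transition map.\<close>

lemma smooth_map_id: "smooth_manifold M \<Longrightarrow> smooth_map M M (\<lambda>x. x)"
  using atlas_compatible[of M]
  by (fastforce simp: smooth_map_def compatible_def comp_def)

lemma smooth_map_const: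
  assumes M: "smooth_manifold M" and N: "smooth_manifold N" and c: "c \<in> points N"
  shows "smooth_map M N (\<lambda>x. c)"
proof (rule smooth_mapI_local[OF M N])
  show "continuous_map (mtop M) (mtop N) (\<lambda>x. c)"
    using c by simp
next
  fix x assume x: "x \<in> points M"
  obtain U \<phi> where U: "(U, \<phi>) \<in> atlas M" "x \<in> U" "is_chart (mtop M) (mdim M) (U, \<phi>)"
    using chart_at[OF M x] .
  obtain V \<psi> where V: "(V, \<psi>) \<in> atlas N" "c \<in> V" "is_chart (mtop N) (mdim N) (V, \<psi>)"
    using chart_at[OF N c] .
  have "openin (Euclidean_space (mdim N)) (\<psi> ` V)"
    using V(3) by (auto simp: is_chart_iff)
  then have "\<psi> c \<in> E (mdim N)"
    using V(2) openin_subset by blast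
  then have "smooth_on (mdim M) (mdim N) (\<phi> ` U) (\<psi> \<circ> (\<lambda>x. c) \<circ> inv_into U \<phi>)"
    by (simp add: comp_def smooth_on_const)
  moreover have "openin (mtop M) U" using U by (simp add: is_chart_iff)
  ultimately show "\<exists>U \<phi> V \<psi> A. (U, \<phi>) \<in> atlas M \<and> (V, \<psi>) \<in> atlas N \<and>
      openin (mtop M) A \<and> x \<in> A \<and> A \<subseteq> U \<and> (\<lambda>x. c) ` A \<subseteq> V \<and>
      smooth_on (mdim M) (mdim N) (\<phi> ` A) (\<psi> \<circ> (\<lambda>x. c) \<circ> inv_into U \<phi>)"
    using U V by blast
qed

subsection \<open>Open submanifolds\<close>

lemma open_submfd_simps [simp]:
  "mtop (open_submfd M W) = subtopology (mtop M) W" "mdim (open_submfd M W) = mdim M"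
  "atlas (open_submfd M W) = {c \<in> atlas M. fst c \<subseteq> W}"
  by (simp_all add: open_submfd_def)

text \<open>Membership comes from maximality of the atlas. It guarantees that the charts of
  \<open>M\<close> with domain inside \<open>W\<close> cover \<open>W\<close>, on which the
  definition of \<open>open_submfd\<close> relies.\<close>

lemma restricted_chart_in_atlas:
  assumes M: "smooth_manifold M" and c: "(U, \<phi>) \<in> atlas M" and W: "openin (mtop M) W"
  shows "(U \<inter> W, restrict \<phi> (U \<inter> W)) \<in> atlas M"
proof -
  note U = atlas_is_chart[OF M c]
  have "compatible (mdim M) (U \<inter> W, restrict \<phi> (U \<inter> W)) d" if d: "d \<in> atlas M" for d
  proof (cases d)
    case (Pair V \<psi>)
    then have "is_chart (mtop M) (mdim M) (V, \<psi>)" "compatible (mdim M) (U, \<phi>) (V, \<psi>)"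
      using d atlas_is_chart[OF M] atlas_compatible[OF M c] by auto
    then show ?thesis
      using Pair smooth_transition_restrict[OF U _ W] by (simp add: compatible_iff)
  qed
  then show ?thesis
    by (rule atlas_maximal[OF M is_chart_restrict[OF U W]])
qed

text \<open>The delicate point is maximality: a chart inside \<open>W\<close> is tested only against
  charts inside \<open>W\<close>, yet it has to belong to the atlas of \<open>M\<close>. With a
  chart of \<open>M\<close> on \<open>V\<close> it is compared through the restriction of that chart
  to \<open>V \<inter> W\<close>.\<close>

lemma smooth_manifold_open_submfd:
  assumes M: "smooth_manifold M" and W: "openin (mtop M) W"
  shows "smooth_manifold (open_submfd M W)"
proof -
  have Wsub: "W \<subseteq> points M" using W openin_subset by blast
  have charts: "is_chart (subtopology (mtop M) W) (mdim M) c" if "c \<in> atlas M" "fst c \<subseteq> W" for c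
    using that atlas_is_chart[OF M] is_chart_subtopology[OF W] by (cases c) auto
  have cover: "(\<Union>(U, \<phi>)\<in>{c \<in> atlas M. fst c \<subseteq> W}. U) = W"
  proof (intro equalityI subsetI)
    fix x assume x: "x \<in> W"
    then obtain U \<phi> where U: "(U, \<phi>) \<in> atlas M" "x \<in> U"
      using chart_at[OF M] Wsub by (metis subsetD)
    then have "(U \<inter> W, restrict \<phi> (U \<inter> W)) \<in> {c \<in> atlas M. fst c \<subseteq> W}"
      using restricted_chart_in_atlas[OF M _ W] by auto
    then show "x \<in> (\<Union>(U, \<phi>)\<in>{c \<in> atlas M. fst c \<subseteq> W}. U)"
      using x U by blast
  qed auto
  have maximal: "c \<in> atlas M \<and> fst c \<subseteq> W"
    if c: "is_chart (subtopology (mtop M) W) (mdim M) c"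
      and comp: "\<And>d. d \<in> atlas M \<Longrightarrow> fst d \<subseteq> W \<Longrightarrow> compatible (mdim M) c d" for c
  proof (cases c)
    case (Pair U \<phi>)
    have U: "is_chart (mtop M) (mdim M) (U, \<phi>)" "U \<subseteq> W"
      using c Pair is_chart_subtopology[OF W] by auto
    have "compatible (mdim M) (U, \<phi>) d" if d: "d \<in> atlas M" for d
    proof (cases d)
      case d': (Pair V \<psi>)
      have V: "is_chart (mtop M) (mdim M) (V, \<psi>)" and VM: "(V, \<psi>) \<in> atlas M"
        using d d' atlas_is_chart[OF M] by auto
      have *: "(V \<inter> W, restrict \<psi> (V \<inter> W)) \<in> atlas M"
        using restricted_chart_in_atlas[OF M VM W] .
      have ex: "\<exists>X \<theta>. x \<in> X \<and> is_chart (mtop M) (mdim M) (X, \<theta>) \<and>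
          compatible (mdim M) (U, \<phi>) (X, \<theta>) \<and> compatible (mdim M) (X, \<theta>) (V, \<psi>)"
        if "x \<in> U \<inter> V" for x
        using that U(2) * atlas_is_chart[OF M *] atlas_compatible[OF M * VM] comp[OF *] Pair
        by (intro exI[of _ "V \<inter> W"] exI[of _ "restrict \<psi> (V \<inter> W)"]) auto
      have "smooth_transition (mdim M) (U, \<phi>) (V, \<psi>)"
        by (rule smooth_transition_local[OF U(1) V]) (use ex in \<open>unfold compatible_iff, blast\<close>)
      moreover have "smooth_transition (mdim M) (V, \<psi>) (U, \<phi>)"
        by (rule smooth_transition_local[OF V U(1)]) (use ex in \<open>unfold compatible_iff, blast\<close>)
      ultimately show ?thesis using d' by (simp add: compatible_iff)
    qed
    then show ?thesis using atlas_maximal[OF M U(1)] U(2) Pair by simp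
  qed
  have top: "Hausdorff_space (subtopology (mtop M) W)" "second_countable (subtopology (mtop M) W)"
    using M by (simp_all add: smooth_manifold_def Hausdorff_space_subtopology second_countable_subtopology)
  have tW: "topspace (subtopology (mtop M) W) = W" using Wsub by auto
  show ?thesis
    unfolding smooth_manifold_def open_submfd_simps tW
  proof (intro conjI ballI allI impI top cover)
    fix c assume "c \<in> {c \<in> atlas M. fst c \<subseteq> W}"
    then show "is_chart (subtopology (mtop M) W) (mdim M) c" by (intro charts) auto
  next
    fix c d assume "c \<in> {c \<in> atlas M. fst c \<subseteq> W}" "d \<in> {c \<in> atlas M. fst c \<subseteq> W}"
    then show "compatible (mdim M) c d" by (intro atlas_compatible[OF M]) auto
  next
    fix c assume "is_chart (subtopology (mtop M) W) (mdim M) c \<and>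
      (\<forall>d\<in>{c \<in> atlas M. fst c \<subseteq> W}. compatible (mdim M) c d)"
    then have "c \<in> atlas M \<and> fst c \<subseteq> W" by (intro maximal) auto
    then show "c \<in> {c \<in> atlas M. fst c \<subseteq> W}" by simp
  qed
qed

lemma points_open_submfd [simp]:
  "openin (mtop M) W \<Longrightarrow> points (open_submfd M W) = W"
  using openin_subset by fastforce

lemma smooth_map_from_open_submfd:
  "smooth_map M N f \<Longrightarrow> smooth_map (open_submfd M W) N f"
  by (fastforce simp: smooth_map_def intro: continuous_map_from_subtopology)

lemma smooth_map_into_open_submfd:
  "smooth_map M N f \<Longrightarrow> f ` points M \<subseteq> W \<Longrightarrow> smooth_map M (open_submfd N W) f"
  by (fastforce simp: smooth_map_def continuous_map_in_subtopology)

text \<open>Inclusion of atlases does not give this, since \<open>N\<close> has charts reaching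
  outside \<open>W\<close>. Composing with the inclusion map does; the inclusion is smooth as a
  restriction of the identity.\<close>

lemma smooth_map_open_submfd_codomain:
  assumes M: "smooth_manifold M" and N: "smooth_manifold N" and W: "openin (mtop N) W"
    and f: "smooth_map M (open_submfd N W) f"
  shows "smooth_map M N f"
  using smooth_map_compose[OF M smooth_manifold_open_submfd[OF N W] N f
      smooth_map_from_open_submfd[OF smooth_map_id[OF N]]]
  by (simp add: comp_def)

lemma open_submfd_open_submfd:
  assumes "V \<subseteq> W"
  shows "open_submfd (open_submfd M W) V = open_submfd M V"
  using assms by (auto simp: open_submfd_def subtopology_subtopology inf.absorb2)

lemma open_submfd_points:
  assumes "smooth_manifold M"
  shows "open_submfd M (points M) = M"
proof -
  have "{c \<in> atlas M. fst c \<subseteq> points M} = atlas M"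
    using chart_subset_points[OF assms] by (metis (mono_tags, lifting) Collect_cong Collect_mem_eq prod.collapse)
  then show ?thesis by (simp add: open_submfd_def)
qed

subsection \<open>Manifolds with a global chart\<close>

text \<open>The standard Euclidean space and its copies on other types are both of this form, so the
  manifold axioms are verified once for both.\<close>

definition global_chart_mfd :: "'m topology \<Rightarrow> nat \<Rightarrow> ('m \<Rightarrow> nat \<Rightarrow> real) \<Rightarrow> 'm mfd" where
  "global_chart_mfd T n \<phi> = \<lparr>mtop = T, mdim = n,
     atlas = {c. is_chart T n c \<and> compatible n c (topspace T, \<phi>)}\<rparr>"

lemma global_chart_mfd_simps [simp]:
  "mtop (global_chart_mfd T n \<phi>) = T" "mdim (global_chart_mfd T n \<phi>) = n"
  "atlas (global_chart_mfd T n \<phi>) = {c. is_chart T n c \<and> compatible n c (topspace T, \<phi>)}"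
  by (simp_all add: global_chart_mfd_def)

lemma compatible_refl:
  assumes "is_chart T n (U, \<phi>)"
  shows "compatible n (U, \<phi>) (U, \<phi>)"
proof -
  have o: "openin (Euclidean_space n) (\<phi> ` U)" and inj: "inj_on \<phi> U"
    using assms by (auto simp: is_chart_iff)
  have "smooth_on n n (\<phi> ` U) (\<phi> \<circ> inv_into U \<phi>)"
    by (rule smooth_on_cong[OF o smooth_on_id[OF openin_subset[OF o]]])
      (use inj in \<open>auto simp: inv_into_f_f\<close>)
  then show ?thesis by (simp add: compatible_def)
qed

lemma smooth_manifold_global_chart_mfd:
  assumes chart: "is_chart T n (topspace T, \<phi>)" and T: "Hausdorff_space T" "second_countable T"
  shows "smooth_manifold (global_chart_mfd T n \<phi>)"
proof -
  have glob: "(topspace T, \<phi>) \<in> atlas (global_chart_mfd T n \<phi>)"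
    using chart compatible_refl by auto
  \<comment> \<open>Any two charts of the atlas are linked through the global chart, which can serve
    as the intermediate chart at every point.\<close>
  have tr: "smooth_transition n (U, \<alpha>) (V, \<beta>)"
    if U: "is_chart T n (U, \<alpha>)" "compatible n (U, \<alpha>) (topspace T, \<phi>)"
    and V: "is_chart T n (V, \<beta>)" "compatible n (V, \<beta>) (topspace T, \<phi>)" for U V \<alpha> \<beta>
  proof (rule smooth_transition_local[OF U(1) V(1)])
    fix x assume "x \<in> U \<inter> V"
    then have "x \<in> topspace T" using U(1) openin_subset by (fastforce simp: is_chart_iff)
    then show "\<exists>W \<theta>. x \<in> W \<and> is_chart T n (W, \<theta>) \<and>
        smooth_transition n (U, \<alpha>) (W, \<theta>) \<and> smooth_transition n (W, \<theta>) (V, \<beta>)"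
      using chart U V by (auto simp: compatible_iff)
  qed
  have "compatible n c d" if "c \<in> atlas (global_chart_mfd T n \<phi>)" "d \<in> atlas (global_chart_mfd T n \<phi>)" for c d
    using that tr by (cases c; cases d) (simp add: compatible_iff)
  moreover have "(\<Union>(U, \<phi>)\<in>atlas (global_chart_mfd T n \<phi>). U) = topspace T"
  proof
    show "topspace T \<subseteq> (\<Union>(U, \<phi>)\<in>atlas (global_chart_mfd T n \<phi>). U)"
      using glob by blast
    show "(\<Union>(U, \<phi>)\<in>atlas (global_chart_mfd T n \<phi>). U) \<subseteq> topspace T"
      using openin_subset by (fastforce simp: is_chart_iff)
  qed
  ultimately show ?thesis
    using T glob unfolding smooth_manifold_def by simp
qed

text \<open>Two global charts turn smoothness into a single \<open>smooth_on\<close> condition. For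
  the converse, continuity of \<open>f\<close> is recovered as well: the chart expression is
  continuous, and \<open>\<phi>\<close> and \<open>\<psi>\<close> are homeomorphisms onto open
  sets.\<close>

lemma smooth_map_global_charts:
  assumes M: "smooth_manifold M" and N: "smooth_manifold N"
    and \<phi>: "(points M, \<phi>) \<in> atlas M" and \<psi>: "(points N, \<psi>) \<in> atlas N"
  shows "smooth_map M N f \<longleftrightarrow> f ` points M \<subseteq> points N \<and>
    smooth_on (mdim M) (mdim N) (\<phi> ` points M) (\<psi> \<circ> f \<circ> inv_into (points M) \<phi>)"
    (is "?L \<longleftrightarrow> ?R1 \<and> ?R2")
proof
  assume ?L
  then have R1: ?R1 using smooth_map_image[OF \<open>?L\<close>] by blast
  then have "points M \<inter> f -` points N = points M" by auto
  then show "?R1 \<and> ?R2" using R1 smooth_map_in_charts[OF \<open>?L\<close> \<phi> \<psi>] by simp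
next
  assume R: "?R1 \<and> ?R2"
  note U = atlas_is_chart[OF M \<phi>] and V = atlas_is_chart[OF N \<psi>]
  have inj: "inj_on \<phi> (points M)" "inj_on \<psi> (points N)"
    using U V by (auto simp: is_chart_iff)
  have oU: "openin (Euclidean_space (mdim M)) (\<phi> ` points M)"
    using U by (auto simp: is_chart_iff)
  have cont: "continuous_map (mtop M) (mtop N) f"
    unfolding continuous_map_def
  proof (intro conjI allI impI)
    show "f \<in> points M \<rightarrow> points N" using R by auto
    fix B assume B: "openin (mtop N) B"
    then have "openin (Euclidean_space (mdim N)) (\<psi> ` B)"
      using V openin_subset[OF B] by (auto simp: is_chart_iff)
    then have "openin (mtop M) (points M \<inter> \<phi> -` (\<phi> ` points M \<inter> (\<psi> \<circ> f \<circ> inv_into (points M) \<phi>) -` \<psi> ` B))"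
      using U openin_smooth_on_vimage[OF conjunct2[OF R] oU] unfolding is_chart_iff by blast
    moreover have "points M \<inter> \<phi> -` (\<phi> ` points M \<inter> (\<psi> \<circ> f \<circ> inv_into (points M) \<phi>) -` \<psi> ` B)
        = {x \<in> points M. f x \<in> B}"
    proof (rule set_eqI)
      fix x
      have "f x \<in> B \<longleftrightarrow> \<psi> (f x) \<in> \<psi> ` B" if "x \<in> points M"
        using inj_on_image_mem_iff[OF inj(2) _ openin_subset[OF B]] R that by blast
      then show "x \<in> points M \<inter> \<phi> -` (\<phi> ` points M \<inter> (\<psi> \<circ> f \<circ> inv_into (points M) \<phi>) -` \<psi> ` B) \<longleftrightarrow>
          x \<in> {x \<in> points M. f x \<in> B}"
        by (cases "x \<in> points M") (simp_all add: inv_into_f_f[OF inj(1)])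
    qed
    ultimately show "openin (mtop M) {x \<in> points M. f x \<in> B}" by simp
  qed
  show ?L
    by (rule smooth_mapI_local[OF M N cont]) (use R \<phi> \<psi> openin_topspace in blast)
qed

subsection \<open>The standard manifold \<open>\<real>\<^sup>n\<close> and its copies\<close>

lemma Rn_eq: "Rn n = global_chart_mfd (Euclidean_space n) n (restrict id (E n))"
  by (simp add: Rn_def global_chart_mfd_def)

lemma Rn_simps [simp]: "mtop (Rn n) = Euclidean_space n" "mdim (Rn n) = n"
  by (simp_all add: Rn_eq)

lemma is_chart_id:
  assumes "openin (Euclidean_space n) V"
  shows "is_chart (Euclidean_space n) n (V, restrict id V)"
proof -
  have "restrict id V ` A = A" if "A \<subseteq> V" for A using that by auto
  moreover have "V \<inter> restrict id V -` B = V \<inter> B" for B by auto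
  ultimately show ?thesis using assms by (auto simp: is_chart_iff inj_on_def)
qed

text \<open>Inherited by subspaces from \<open>nat \<Rightarrow> real\<close>, a countable power of
  the real line and hence a type with a countable basis.\<close>

lemma second_countable_Euclidean_space: "second_countable (Euclidean_space n)"
proof -
  obtain B :: "(nat \<Rightarrow> real) set set" where B: "countable B" "topological_basis B"
    using ex_countable_basis by blast
  have "second_countable (euclidean :: (nat \<Rightarrow> real) topology)"
    unfolding second_countable_def
    using B topological_basis_open[OF B(2)] topological_basisE[OF B(2)]
    by (intro exI[of _ B] conjI) (auto, metis)
  then show ?thesis
    by (metis Euclidean_space_top_of_set second_countable_subtopology)
qed

lemma smooth_manifold_Rn: "smooth_manifold (Rn n)"
  unfolding Rn_eq using is_chart_id[of n "E n"]
  by (intro smooth_manifold_global_chart_mfd Hausdorff_Euclidean_space second_countable_Euclidean_space) auto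

text \<open>Provides every open subset of Euclidean space, seen as a submanifold, with a global
  chart.\<close>

lemma id_chart_in_atlas:
  assumes V: "openin (Euclidean_space n) V"
  shows "(V, restrict id V) \<in> atlas (Rn n)"
proof -
  have "(E n, restrict id (E n)) \<in> atlas (Rn n)"
    using is_chart_id[of n "E n"] compatible_refl by (simp add: Rn_eq)
  moreover have "E n \<inter> V = V" using openin_subset[OF V] by blast
  moreover have "restrict (restrict id (E n)) V = restrict id V"
    using openin_subset[OF V] by (auto simp: restrict_def fun_eq_iff)
  ultimately show ?thesis
    using restricted_chart_in_atlas[OF smooth_manifold_Rn, of "E n" "restrict id (E n)" n V] V by simp
qed

text \<open>The bridge between the two notions of smoothness: the axioms for classical plots speak
  of \<open>smooth_on\<close>, the conversions below of maps between manifolds.\<close>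

lemma smooth_map_Rn_iff:
  assumes V: "openin (Euclidean_space m) V" and U: "openin (Euclidean_space n) U"
  shows "smooth_map (open_submfd (Rn m) V) (open_submfd (Rn n) U) f \<longleftrightarrow> f ` V \<subseteq> U \<and> smooth_on m n V f"
proof -
  let ?g = "restrict id U \<circ> f \<circ> inv_into V (restrict id V)"
  have inv: "inv_into V (restrict id V) x = x" if "x \<in> V" for x
    using inv_into_f_f[of "restrict id V" V x] that by (simp add: inj_on_def)
  have img: "restrict id V ` V = V" by auto
  have pts: "points (open_submfd (Rn m) V) = V" "points (open_submfd (Rn n) U) = U"
    using V U by (simp_all add: points_open_submfd del: open_submfd_simps)
  have "smooth_map (open_submfd (Rn m) V) (open_submfd (Rn n) U) f \<longleftrightarrow>
      f ` V \<subseteq> U \<and> smooth_on m n (restrict id V ` V) ?g"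
    using smooth_map_global_charts[of "open_submfd (Rn m) V" "open_submfd (Rn n) U" "restrict id V" "restrict id U" f,
      unfolded pts] smooth_manifold_open_submfd[OF smooth_manifold_Rn]
      id_chart_in_atlas[OF U] id_chart_in_atlas[OF V] V U by simp
  moreover have "smooth_on m n V ?g \<longleftrightarrow> smooth_on m n V f" if "f ` V \<subseteq> U"
  proof
    assume "smooth_on m n V ?g"
    then show "smooth_on m n V f"
      by (rule smooth_on_cong[OF V]) (use inv that in auto)
  next
    assume "smooth_on m n V f"
    then show "smooth_on m n V ?g"
      by (rule smooth_on_cong[OF V]) (use inv that in auto)
  qed
  ultimately show ?thesis unfolding img by blast
qed

lemma open_submfd_Rn_E: "open_submfd (Rn n) (E n) = Rn n"
  using open_submfd_points[OF smooth_manifold_Rn, of n] by simp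

text \<open>Read in the global charts, both \<open>\<phi>\<close> and its inverse become the
  identity of \<open>E n\<close>.\<close>

lemma diffeomorphic_global_chart_mfd_Rn:
  assumes chart: "is_chart T n (topspace T, \<phi>)" and surj: "\<phi> ` topspace T = E n"
    and M: "smooth_manifold (global_chart_mfd T n \<phi>)"
  shows "diffeomorphic (global_chart_mfd T n \<phi>) (Rn n)"
proof -
  let ?M = "global_chart_mfd T n \<phi>"
  have inj: "inj_on \<phi> (topspace T)"
    using chart by (simp add: is_chart_iff)
  have a: "(points ?M, \<phi>) \<in> atlas ?M"
    using chart compatible_refl by simp
  have b: "(points (Rn n), restrict id (E n)) \<in> atlas (Rn n)"
    using id_chart_in_atlas[of n "E n"] by simp
  have inv: "inv_into (E n) (restrict id (E n)) x = x" if "x \<in> E n" for x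
    using inv_into_f_f[of "restrict id (E n)" "E n" x] that by (simp add: inj_on_def)
  have img: "restrict id (E n) ` E n = E n" by auto
  have sm: "smooth_on n n (E n) f" if "\<And>x. x \<in> E n \<Longrightarrow> x = f x" for f
    by (rule smooth_on_cong[OF _ smooth_on_id that]) auto
  have left: "inv_into (topspace T) \<phi> (\<phi> x) = x" if "x \<in> topspace T" for x
    using inv_into_f_f[OF inj that] .
  have right: "\<phi> (inv_into (topspace T) \<phi> y) = y" "inv_into (topspace T) \<phi> y \<in> topspace T" if "y \<in> E n" for y
    using f_inv_into_f inv_into_into that surj by metis+
  have "smooth_map ?M (Rn n) \<phi>"
    unfolding smooth_map_global_charts[OF M smooth_manifold_Rn a b]
    using surj right by (auto intro!: sm)
  moreover have "smooth_map (Rn n) ?M (inv_into (topspace T) \<phi>)"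
    unfolding smooth_map_global_charts[OF smooth_manifold_Rn M b a]
    using right inv by (auto simp: img intro!: sm)
  ultimately show ?thesis
    unfolding diffeomorphic_def using left right(1) by auto
qed

lemma copy_of_Rn_exists:
  assumes "inj (e :: (nat \<Rightarrow> real) \<Rightarrow> 'm)"
  shows "\<exists>K :: 'm mfd. smooth_manifold K \<and> diffeomorphic K (Rn n)"
proof -
  \<comment> \<open>Pulling back along the left inverse \<open>inv e\<close> makes the open sets
    exactly the images under \<open>e\<close> of open sets of Euclidean space. The separation and
    countability axioms then follow by homeomorphism.\<close>
  define T where "T = pullback_topology (e ` E n) (inv e) (Euclidean_space n)"
  define \<phi> where "\<phi> = restrict (inv e) (e ` E n)"
  have inv: "inv e (e x) = x" for x using assms by simp
  have T: "topspace T = e ` E n"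
    using inv by (auto simp: T_def topspace_pullback_topology)
  have \<phi>: "\<phi> (e x) = x" if "x \<in> E n" for x
    using that inv by (simp add: \<phi>_def)
  have openT: "openin T A \<longleftrightarrow> (\<exists>B. openin (Euclidean_space n) B \<and> A = e ` B)" for A
  proof -
    have "inv e -` B \<inter> e ` E n = e ` B" if "openin (Euclidean_space n) B" for B
      using openin_subset[OF that] inv by auto
    then show ?thesis
      unfolding T_def openin_pullback_topology by metis
  qed
  have surj: "\<phi> ` topspace T = E n"
    unfolding T image_image using \<phi> by simp
  have "is_chart T n (topspace T, \<phi>)"
    unfolding is_chart_iff
  proof (intro conjI allI impI)
    show "\<phi> \<in> extensional (topspace T)" by (simp add: T \<phi>_def)
    show "inj_on \<phi> (topspace T)" by (auto simp: T inj_on_def \<phi>)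
  next
    fix A assume "openin T A \<and> A \<subseteq> topspace T"
    then obtain B where B: "openin (Euclidean_space n) B" "A = e ` B"
      using openT by blast
    have "\<phi> ` e ` B = B"
      using openin_subset[OF B(1)] \<phi> by (force simp: image_image)
    then show "openin (Euclidean_space n) (\<phi> ` A)" using B by simp
  next
    fix B assume B: "openin (Euclidean_space n) B"
    have "topspace T \<inter> \<phi> -` B = e ` B"
      using openin_subset[OF B] \<phi> by (auto simp: T)
    then show "openin T (topspace T \<inter> \<phi> -` B)" using B openT by metis
  qed auto
  note chart = this
  then have "homeomorphic_map (subtopology T (topspace T)) (subtopology (Euclidean_space n) (E n)) \<phi>"
    using surj by (simp add: is_chart_def)
  then have "T homeomorphic_space Euclidean_space n"
    using homeomorphic_map_imp_homeomorphic_space by (metis subtopology_topspace)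
  then have "Hausdorff_space T" "second_countable T"
    using homeomorphic_Hausdorff_space homeomorphic_space_second_countability
      Hausdorff_Euclidean_space second_countable_Euclidean_space by blast+
  then have "smooth_manifold (global_chart_mfd T n \<phi>)"
    by (rule smooth_manifold_global_chart_mfd[OF chart])
  then show ?thesis
    using diffeomorphic_global_chart_mfd_Rn[OF chart surj] by blast
qed

subsection \<open>Boxes\<close>

definition Box :: "nat \<Rightarrow> (nat \<Rightarrow> real) \<Rightarrow> (nat \<Rightarrow> real) \<Rightarrow> (nat \<Rightarrow> real) set" where
  "Box n a b = {x \<in> E n. \<forall>i<n. a i < x i \<and> x i < b i}"

lemma openin_Box: "openin (Euclidean_space n) (Box n a b)"
proof -
  have "open {x :: nat \<Rightarrow> real. a i < x i}" "open {x :: nat \<Rightarrow> real. x i < b i}" for i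
    by (intro open_Collect_less continuous_intros continuous_on_product_coordinates)+
  then have "open (\<Inter>i<n. {x :: nat \<Rightarrow> real. a i < x i} \<inter> {x. x i < b i})"
    by (intro open_INT ballI open_Int) auto
  moreover have "Box n a b = E n \<inter> (\<Inter>i<n. {x. a i < x i} \<inter> {x. x i < b i})"
    by (auto simp: Box_def)
  ultimately show ?thesis
    unfolding openin_Euclidean_space by blast
qed

lemma Box_neighbourhood:
  assumes "openin (Euclidean_space n) T" "y \<in> T"
  obtains a b where "y \<in> Box n a b" "Box n a b \<subseteq> T"
proof -
  obtain r where r: "r > 0" "\<And>z. z \<in> E n \<Longrightarrow> (\<And>i. i < n \<Longrightarrow> \<bar>z i - y i\<bar> < r) \<Longrightarrow> z \<in> T"
    by (rule openin_Euclidean_space_contains_box[OF assms]) blast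
  have "y \<in> E n" using assms openin_subset by blast
  then have "y \<in> Box n (\<lambda>i. y i - r) (\<lambda>i. y i + r)"
    using r(1) by (auto simp: Box_def)
  moreover have "Box n (\<lambda>i. y i - r) (\<lambda>i. y i + r) \<subseteq> T"
    by (auto simp: Box_def abs_less_iff intro!: r(2))
  ultimately show ?thesis using that by blast
qed

lemma Box_Int: "Box n a b \<inter> Box n c d = Box n (\<lambda>i. max (a i) (c i)) (\<lambda>i. min (b i) (d i))"
  by (auto simp: Box_def)

section \<open>The diffeomorphism between a nonempty box and Euclidean space\<close>

text \<open>The logistic function \<open>s\<close> has derivative \<open>s * (1 - s)\<close>, a
  polynomial in \<open>s\<close> itself, so induction on the order closes. The difference is written
  \<open>1 + (-1) * s\<close> to match the rules for sums, products and constants.\<close>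

lemma Ck_on_logistic: "Ck_on k m S (\<lambda>x. 1 / (1 + exp (- x j)))"
proof (induction k)
  case 0
  have pos: "1 + exp (- x j) \<noteq> 0" for x :: "nat \<Rightarrow> real"
    using exp_gt_zero[of "- x j"] by linarith
  have "continuous_on S (\<lambda>x. x j)"
    by (rule continuous_on_subset[OF continuous_on_product_coordinates subset_UNIV])
  then show ?case
    using pos by (auto intro!: continuous_intros)
next
  case (Suc k)
  let ?s = "\<lambda>t::real. 1 / (1 + exp (- t))"
  have "(?s has_real_derivative ?s t * (1 + (-1) * ?s t)) (at t)" for t
  proof -
    have "1 + exp (- t) \<noteq> 0" using exp_gt_zero[of "- t"] by linarith
    then show ?thesis
      by (auto intro!: derivative_eq_intros simp: field_simps)
  qed
  moreover have "Ck_on k m S (\<lambda>x. ?s (x j) * (1 + (-1) * ?s (x j)))"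
    by (intro Ck_on_mult Ck_on_add Ck_on_const Suc.IH)
  ultimately show ?case by (rule Ck_on_Suc_coord)
qed

text \<open>The same scheme as for the logistic function: the derivative of the reciprocal
  \<open>r\<close> is \<open>(-1) * (r * r)\<close>.\<close>

lemma Ck_on_inverse_coord:
  assumes "\<And>x. x \<in> S \<Longrightarrow> x j \<noteq> c"
  shows "Ck_on k m S (\<lambda>x. 1 / (x j - c))"
proof (induction k)
  case 0
  have "continuous_on S (\<lambda>x. x j)"
    by (rule continuous_on_subset[OF continuous_on_product_coordinates subset_UNIV])
  then show ?case
    using assms by (auto intro!: continuous_intros)
next
  case (Suc k)
  let ?r = "\<lambda>t::real. 1 / (t - c)"
  have "(?r has_real_derivative (-1) * (?r (x j) * ?r (x j))) (at (x j))" if "x \<in> S" for x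
    using assms[OF that] by (auto intro!: derivative_eq_intros simp: field_simps power2_eq_square)
  moreover have "Ck_on k m S (\<lambda>x. (-1) * (?r (x j) * ?r (x j)))"
    by (intro Ck_on_mult Ck_on_const Suc.IH)
  ultimately show ?case by (rule Ck_on_Suc_coord)
qed

text \<open>The logarithms disappear after one differentiation: the derivative is
  \<open>1 / (x j - a) + 1 / (b - x j)\<close>, a sum of reciprocals of linear functions. These have
  order \<open>k\<close>, so the function has order \<open>Suc k\<close>, which is then
  weakened.\<close>

lemma Ck_on_logit:
  assumes "\<And>x. x \<in> S \<Longrightarrow> a < x j \<and> x j < b"
  shows "Ck_on k m S (\<lambda>x. ln (x j - a) - ln (b - x j))"
proof -
  have "((\<lambda>t. ln (t - a) - ln (b - t)) has_real_derivative 1 / (x j - a) + (-1) * (1 / (x j - b))) (at (x j))"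
    if "x \<in> S" for x
  proof -
    have "(-1) * (1 / (x j - b)) = 1 / (b - x j)"
      by (metis divide_minus_right minus_diff_eq mult_minus1)
    then show ?thesis
      using assms[OF that] by (auto intro!: derivative_eq_intros)
  qed
  moreover have "Ck_on k m S (\<lambda>x. 1 / (x j - a) + (-1) * (1 / (x j - b)))"
    using assms by (intro Ck_on_add Ck_on_mult Ck_on_const Ck_on_inverse_coord) force+
  ultimately have "Ck_on (Suc k) m S (\<lambda>x. ln (x j - a) - ln (b - x j))"
    by (rule Ck_on_Suc_coord)
  then show ?thesis by (rule Ck_on_Suc_imp)
qed

lemma diffeomorphic_Box_Rn:
  assumes ab: "\<And>i. i < n \<Longrightarrow> a i < b i"
  shows "diffeomorphic (open_submfd (Rn n) (Box n a b)) (Rn n)"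
proof -
  \<comment> \<open>In each coordinate \<open>g\<close> is the logistic function stretched from the
    unit interval to the interval from \<open>a i\<close> to \<open>b i\<close>. Its inverse is the
    logarithm of \<open>(x i - a i) / (b i - x i)\<close>, split into a difference to fit
    \<open>Ck_on_logit\<close>. The value 0 from index \<open>n\<close> on keeps both maps in
    \<open>E n\<close>.\<close>
  define f where "f x = (\<lambda>i. if i < n then ln (x i - a i) - ln (b i - x i) else 0)" for x :: "nat \<Rightarrow> real"
  define g where "g x = (\<lambda>i. if i < n then a i + (b i - a i) * (1 / (1 + exp (- x i))) else 0)" for x :: "nat \<Rightarrow> real"
  let ?B = "Box n a b"
  have pos: "1 + exp (- t) > 0" for t :: real
    using exp_gt_zero[of "- t"] by linarith
  have fg: "f (g x) = x" if "x \<in> E n" for x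
  proof
    fix i
    show "f (g x) i = x i"
    proof (cases "i < n")
      case True
      let ?s = "1 + exp (- x i)"
      have d: "b i - a i > 0" using ab[OF True] by simp
      have "g x i - a i = (b i - a i) / ?s" "b i - g x i = (b i - a i) * exp (- x i) / ?s"
        using True pos[of "x i"] by (simp_all add: g_def field_simps)
      then have "f (g x) i = ln ((b i - a i) / ?s) - ln ((b i - a i) * exp (- x i) / ?s)"
        using True by (simp add: f_def)
      also have "\<dots> = x i"
        using d pos[of "x i"] by (simp add: ln_div ln_mult)
      finally show ?thesis .
    next
      case False
      then show ?thesis using that by (simp add: f_def in_E_iff)
    qed
  qed
  have gf: "g (f x) = x" if x: "x \<in> ?B" for x
  proof
    fix i
    show "g (f x) i = x i"
    proof (cases "i < n")
      case True
      then have *: "x i - a i > 0" "b i - x i > 0" "b i - a i > 0"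
        using x ab by (auto simp: Box_def)
      have "exp (- f x i) = (b i - x i) / (x i - a i)"
        using True * by (simp add: f_def exp_diff)
      then have "1 + exp (- f x i) = (b i - a i) / (x i - a i)"
        using * by (simp add: field_simps)
      then show ?thesis using True * by (simp add: g_def)
    next
      case False
      then show ?thesis using x by (simp add: g_def Box_def in_E_iff)
    qed
  qed
  have gB: "g x \<in> ?B" for x
  proof -
    have "a i < g x i \<and> g x i < b i" if "i < n" for i
    proof -
      have "0 < 1 / (1 + exp (- x i))" "1 / (1 + exp (- x i)) < 1"
        using pos[of "x i"] by simp_all
      then have "0 < (b i - a i) * (1 / (1 + exp (- x i)))"
        "(b i - a i) * (1 / (1 + exp (- x i))) < (b i - a i) * 1"
        using ab[OF that] by (intro mult_pos_pos mult_strict_left_mono; simp)+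
      then show ?thesis using that by (simp add: g_def)
    qed
    then show ?thesis by (auto simp: Box_def in_E_iff g_def)
  qed
  have fE: "f x \<in> E n" for x by (simp add: in_E_iff f_def)
  have "smooth_on n n ?B f"
    unfolding smooth_on_def
  proof (intro conjI allI impI)
    show "f ` ?B \<subseteq> E n" using fE by blast
    fix j k assume "j < n"
    then show "Ck_on k n ?B (\<lambda>x. f x j)"
      using Ck_on_logit[of ?B "a j" j "b j" k n] by (simp add: f_def Box_def)
  qed
  moreover have "smooth_on n n (E n) g"
    unfolding smooth_on_def
  proof (intro conjI allI impI)
    show "g ` E n \<subseteq> E n" using gB by (auto simp: Box_def)
    fix j k assume j: "j < n"
    have "Ck_on k n (E n) (\<lambda>x. a j + (b j - a j) * (1 / (1 + exp (- x j))))"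
      by (intro Ck_on_add Ck_on_mult Ck_on_const Ck_on_logistic)
    then show "Ck_on k n (E n) (\<lambda>x. g x j)"
      using j by (simp add: g_def)
  qed
  ultimately have "smooth_map (open_submfd (Rn n) ?B) (Rn n) f" "smooth_map (Rn n) (open_submfd (Rn n) ?B) g"
    using smooth_map_Rn_iff[OF openin_Box[of n a b], of n "E n" f]
      smooth_map_Rn_iff[of n "E n" n ?B g] openin_Box[of n a b] fE gB
    by (auto simp: open_submfd_Rn_E)
  moreover have "points (open_submfd (Rn n) ?B) = ?B"
    using openin_Box by (simp add: points_open_submfd del: open_submfd_simps)
  ultimately show ?thesis
    unfolding diffeomorphic_def using fg gf by (intro exI[of _ f] exI[of _ g]) (simp del: open_submfd_simps)
qed

section \<open>Boxes inside cartesian spaces and good open covers\<close>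

lemma diffeomorphic_trans:
  assumes M: "smooth_manifold M" and N: "smooth_manifold N" and K: "smooth_manifold K"
    and MN: "diffeomorphic M N" and NK: "diffeomorphic N K"
  shows "diffeomorphic M K"
proof -
  obtain f g where fg: "smooth_map M N f" "smooth_map N M g"
      "\<And>x. x \<in> points M \<Longrightarrow> g (f x) = x" "\<And>y. y \<in> points N \<Longrightarrow> f (g y) = y"
    using MN unfolding diffeomorphic_def by blast
  obtain f' g' where fg': "smooth_map N K f'" "smooth_map K N g'"
      "\<And>x. x \<in> points N \<Longrightarrow> g' (f' x) = x" "\<And>y. y \<in> points K \<Longrightarrow> f' (g' y) = y"
    using NK unfolding diffeomorphic_def by blast
  show ?thesis
    unfolding diffeomorphic_def
    using smooth_map_compose[OF M N K fg(1) fg'(1)] smooth_map_compose[OF K N M fg'(2) fg(2)]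
      fg(3,4) fg'(3,4) smooth_map_image[OF fg(1)] smooth_map_image[OF fg'(2)]
    by (intro exI[of _ "f' \<circ> f"] exI[of _ "g \<circ> g'"]) simp
qed

lemma diffeomorphic_open_submfd_vimage:
  assumes M: "smooth_manifold M" and N: "smooth_manifold N"
    and f: "smooth_map M N f" and g: "smooth_map N M g"
    and gf: "\<And>x. x \<in> points M \<Longrightarrow> g (f x) = x" and fg: "\<And>y. y \<in> points N \<Longrightarrow> f (g y) = y"
    and B: "openin (mtop N) B"
  shows "diffeomorphic (open_submfd M (points M \<inter> f -` B)) (open_submfd N B)"
proof -
  let ?W = "points M \<inter> f -` B"
  have W: "openin (mtop M) ?W"
    using openin_Int_vimage[OF smooth_map_continuous[OF f] openin_topspace B] .
  have pts: "points (open_submfd M ?W) = ?W" "points (open_submfd N B) = B"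
    using points_open_submfd[OF W] points_open_submfd[OF B] by auto
  have BN: "B \<subseteq> points N" using openin_subset[OF B] .
  have "smooth_map (open_submfd M ?W) (open_submfd N B) f"
    by (rule smooth_map_into_open_submfd[OF smooth_map_from_open_submfd[OF f]]) (use pts in auto)
  moreover have "smooth_map (open_submfd N B) (open_submfd M ?W) g"
    by (rule smooth_map_into_open_submfd[OF smooth_map_from_open_submfd[OF g]])
      (use pts BN smooth_map_image[OF g] fg in auto)
  ultimately show ?thesis
    unfolding diffeomorphic_def pts using gf fg BN by blast
qed

text \<open>A point of the preimage forces \<open>a i < b i\<close> for all \<open>i < n\<close>,
  which is what the diffeomorphism of a box with Euclidean space requires.\<close>

lemma cartesian_space_open_submfd_Box:
  assumes M: "smooth_manifold M" and f: "smooth_map M (Rn n) f" and g: "smooth_map (Rn n) M g"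
    and gf: "\<And>x. x \<in> points M \<Longrightarrow> g (f x) = x" and fg: "\<And>y. y \<in> E n \<Longrightarrow> f (g y) = y"
    and ne: "points M \<inter> f -` Box n a b \<noteq> {}"
  shows "cartesian_space (open_submfd M (points M \<inter> f -` Box n a b))"
proof -
  have B: "openin (mtop (Rn n)) (Box n a b)" by (simp add: openin_Box)
  have W: "openin (mtop M) (points M \<inter> f -` Box n a b)"
    using openin_Int_vimage[OF smooth_map_continuous[OF f] openin_topspace B] .
  have "a i < b i" if "i < n" for i
    using ne that by (force simp: Box_def)
  then have "diffeomorphic (open_submfd (Rn n) (Box n a b)) (Rn n)"
    by (rule diffeomorphic_Box_Rn)
  moreover have "diffeomorphic (open_submfd M (points M \<inter> f -` Box n a b)) (open_submfd (Rn n) (Box n a b))"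
    by (rule diffeomorphic_open_submfd_vimage[OF M smooth_manifold_Rn f g gf _ B]) (use fg in auto)
  ultimately have "diffeomorphic (open_submfd M (points M \<inter> f -` Box n a b)) (Rn n)"
    using diffeomorphic_trans smooth_manifold_open_submfd[OF M W]
      smooth_manifold_open_submfd[OF smooth_manifold_Rn B] smooth_manifold_Rn by blast
  then show ?thesis
    using smooth_manifold_open_submfd[OF M W] unfolding cartesian_space_def by blast
qed

lemma good_open_cover_refinement:
  assumes M: "cartesian_space M"
    and \<O>: "\<And>A. A \<in> \<O> \<Longrightarrow> openin (mtop M) A" "\<Union>\<O> = points M"
  obtains \<U> where "good_open_cover M \<U>" "\<And>W. W \<in> \<U> \<Longrightarrow> \<exists>A\<in>\<O>. W \<subseteq> A"
proof -
  obtain n f g where sM: "smooth_manifold M" and fg: "smooth_map M (Rn n) f" "smooth_map (Rn n) M g"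
      "\<And>x. x \<in> points M \<Longrightarrow> g (f x) = x" "\<And>y. y \<in> E n \<Longrightarrow> f (g y) = y"
    using M unfolding cartesian_space_def diffeomorphic_def by auto
  define P where "P a b = points M \<inter> f -` Box n a b" for a b
  \<comment> \<open>Empty preimages are excluded because every member of a good cover must be a
    cartesian space. Taking all preimages of boxes that fit into some member of \<open>\<O>\<close>
    avoids choosing one for each point.\<close>
  define \<U> where "\<U> = {W. W \<noteq> {} \<and> (\<exists>a b. W = P a b) \<and> (\<exists>A\<in>\<O>. W \<subseteq> A)}"
  have openP: "openin (mtop M) (P a b)" for a b
    unfolding P_def using openin_Int_vimage[OF smooth_map_continuous[OF fg(1)] openin_topspace]
    by (simp add: openin_Box)
  have cart: "cartesian_space (open_submfd M (P a b))" if "P a b \<noteq> {}" for a b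
    using cartesian_space_open_submfd_Box[OF sM fg] that unfolding P_def by blast
  have P_Int: "P a b \<inter> P c d = P (\<lambda>i. max (a i) (c i)) (\<lambda>i. min (b i) (d i))" for a b c d
    unfolding P_def Box_Int[symmetric] by auto
  \<comment> \<open>The intersection may still be empty here; it then has the form
    \<open>P a b\<close> all the same. Nonemptiness is supplied later by the condition in
    \<open>good_open_cover\<close>.\<close>
  have Inter: "\<exists>a b. \<Inter>\<F> = P a b" if "finite \<F>" "\<F> \<noteq> {}" "\<F> \<subseteq> \<U>" for \<F>
    using that
  proof (induction \<F> rule: finite_ne_induct)
    case (singleton W)
    then show ?case by (auto simp: \<U>_def)
  next
    case (insert W \<F>)
    then obtain a b c d where "W = P a b" "\<Inter>\<F> = P c d"
      by (auto simp: \<U>_def)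
    then show ?case using P_Int by auto
  qed
  have "x \<in> \<Union>\<U>" if x: "x \<in> points M" for x
  proof -
    obtain A where A: "A \<in> \<O>" "x \<in> A" using x \<O>(2) by blast
    \<comment> \<open>\<open>A\<close> is moved to Euclidean space as its preimage under the inverse
      diffeomorphism \<open>g\<close>. A box around \<open>f x\<close> inside this preimage pulls
      back into \<open>A\<close>, because \<open>g\<close> undoes \<open>f\<close>.\<close>
    have "openin (Euclidean_space n) (E n \<inter> g -` A)"
      using openin_Int_vimage[OF smooth_map_continuous[OF fg(2)], of "E n" A] \<O>(1)[OF A(1)] by simp
    moreover have "f x \<in> E n \<inter> g -` A"
      using fg(3)[OF x] A(2) smooth_map_image[OF fg(1) x] by simp
    ultimately obtain a b where ab: "f x \<in> Box n a b" "Box n a b \<subseteq> E n \<inter> g -` A"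
      by (rule Box_neighbourhood)
    have "P a b \<subseteq> A" using ab(2) fg(3) by (force simp: P_def)
    moreover have "x \<in> P a b" using x ab(1) by (simp add: P_def)
    ultimately have "P a b \<in> \<U>" using A(1) by (auto simp: \<U>_def)
    then show ?thesis using \<open>x \<in> P a b\<close> by blast
  qed
  moreover have "W \<subseteq> points M" if "W \<in> \<U>" for W
    using that by (auto simp: \<U>_def P_def)
  ultimately have "\<Union>\<U> = points M" by blast
  moreover have "openin (mtop M) W \<and> cartesian_space (open_submfd M W)" if W: "W \<in> \<U>" for W
  proof -
    obtain a b where "W = P a b" "P a b \<noteq> {}"
      using W unfolding \<U>_def by blast
    then show ?thesis using openP cart by blast
  qed
  moreover have "cartesian_space (open_submfd M (\<Inter>\<F>))"
    if "finite \<F> \<and> \<F> \<noteq> {} \<and> \<F> \<subseteq> \<U> \<and> \<Inter>\<F> \<noteq> {}" for \<F>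
    using Inter[of \<F>] cart that by metis
  ultimately have "good_open_cover M \<U>"
    unfolding good_open_cover_def by blast
  then show ?thesis using that by (auto simp: \<U>_def)
qed

subsection \<open>Converting diffeologies\<close>

abbreviation open_Rn :: "nat \<Rightarrow> (nat \<Rightarrow> real) set \<Rightarrow> (nat \<Rightarrow> real) mfd" where
  "open_Rn n V \<equiv> open_submfd (Rn n) V"

lemma smooth_manifold_open_Rn: "openin (Euclidean_space n) V \<Longrightarrow> smooth_manifold (open_Rn n V)"
  by (simp add: smooth_manifold_open_submfd smooth_manifold_Rn)

lemma points_open_Rn: "openin (Euclidean_space n) V \<Longrightarrow> points (open_Rn n V) = V"
  by (simp add: points_open_submfd del: open_submfd_simps)

definition diff_plots ::
    "'x set \<Rightarrow> (nat \<times> (nat \<Rightarrow> real) set \<times> ((nat \<Rightarrow> real) \<Rightarrow> 'x)) set \<Rightarrow> ('m mfd \<times> ('m \<Rightarrow> 'x)) set" where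
  "diff_plots X P = {(U, p). cartesian_space U \<and> p \<in> points U \<rightarrow>\<^sub>E X \<and>
     (\<forall>n V f. openin (Euclidean_space n) V \<and> smooth_map (open_Rn n V) U f \<longrightarrow> (n, V, compose V p f) \<in> P)}"

definition classical_plots ::
    "'x set \<Rightarrow> ('m mfd \<times> ('m \<Rightarrow> 'x)) set \<Rightarrow> (nat \<times> (nat \<Rightarrow> real) set \<times> ((nat \<Rightarrow> real) \<Rightarrow> 'x)) set" where
  "classical_plots X P = {(n, U, p). openin (Euclidean_space n) U \<and> p \<in> U \<rightarrow>\<^sub>E X \<and>
     (\<forall>V f. cartesian_space V \<and> smooth_map V (open_Rn n U) f \<longrightarrow> (V, compose (points V) p f) \<in> P)}"

lemma compose_PiE: "f ` A \<subseteq> B \<Longrightarrow> p \<in> B \<rightarrow>\<^sub>E X \<Longrightarrow> compose A p f \<in> A \<rightarrow>\<^sub>E X"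
  by (auto simp: compose_def)

lemma compose_compose: "f ` A \<subseteq> B \<Longrightarrow> compose A (compose B p g) f = compose A p (g \<circ> f)"
  by (auto simp: compose_def fun_eq_iff restrict_def)

lemma compose_restrict: "A \<subseteq> B \<Longrightarrow> f ` A \<subseteq> C \<Longrightarrow> compose A (restrict p C) f = restrict (compose B p f) A"
  by (auto simp: compose_def fun_eq_iff restrict_def)

lemma cartesian_space_manifold: "cartesian_space M \<Longrightarrow> smooth_manifold M"
  by (simp add: cartesian_space_def)

lemma classical_diffeologyD:
  assumes "classical_diffeology X P"
  shows "(n, U, p) \<in> P \<Longrightarrow> openin (Euclidean_space n) U" "(n, U, p) \<in> P \<Longrightarrow> p \<in> U \<rightarrow>\<^sub>E X"
    and "c \<in> X \<Longrightarrow> openin (Euclidean_space n) U \<Longrightarrow> (n, U, \<lambda>u\<in>U. c) \<in> P"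
    and "(n, U, p) \<in> P \<Longrightarrow> openin (Euclidean_space m) V \<Longrightarrow> smooth_on m n V f \<Longrightarrow> f ` V \<subseteq> U \<Longrightarrow>
      (m, V, compose V p f) \<in> P"
    and "openin (Euclidean_space n) U \<Longrightarrow> p \<in> U \<rightarrow>\<^sub>E X \<Longrightarrow>
      (\<And>u. u \<in> U \<Longrightarrow> \<exists>V. openin (Euclidean_space n) V \<and> u \<in> V \<and> V \<subseteq> U \<and> (n, V, restrict p V) \<in> P) \<Longrightarrow>
      (n, U, p) \<in> P"
proof -
  note D = assms[unfolded classical_diffeology_def]
  note D1 = D[THEN conjunct1] and D2 = D[THEN conjunct2, THEN conjunct1]
    and D3 = D[THEN conjunct2, THEN conjunct2, THEN conjunct1]
    and D4 = D[THEN conjunct2, THEN conjunct2, THEN conjunct2]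
  show "openin (Euclidean_space n) U" "p \<in> U \<rightarrow>\<^sub>E X" if "(n, U, p) \<in> P"
    using bspec[OF D1 that] by simp_all
  show "(n, U, \<lambda>u\<in>U. c) \<in> P" if "c \<in> X" "openin (Euclidean_space n) U"
    using D2[rule_format, OF that] .
  show "(m, V, compose V p f) \<in> P"
    if "(n, U, p) \<in> P" "openin (Euclidean_space m) V" "smooth_on m n V f" "f ` V \<subseteq> U"
    using D3[rule_format, of n U p m V f] that by simp
  show "(n, U, p) \<in> P" if "openin (Euclidean_space n) U" "p \<in> U \<rightarrow>\<^sub>E X"
    "\<And>u. u \<in> U \<Longrightarrow> \<exists>V. openin (Euclidean_space n) V \<and> u \<in> V \<and> V \<subseteq> U \<and> (n, V, restrict p V) \<in> P"
    using D4[THEN spec, THEN spec, THEN spec, of n U p] that by simp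
qed

lemma diffeologyD:
  assumes "diffeology X P"
  shows "(U, p) \<in> P \<Longrightarrow> cartesian_space U" "(U, p) \<in> P \<Longrightarrow> p \<in> points U \<rightarrow>\<^sub>E X"
    and "smooth_manifold U \<Longrightarrow> diffeomorphic U (Rn 0) \<Longrightarrow> p \<in> points U \<rightarrow>\<^sub>E X \<Longrightarrow> (U, p) \<in> P"
    and "(U, p) \<in> P \<Longrightarrow> cartesian_space V \<Longrightarrow> smooth_map V U f \<Longrightarrow> (V, compose (points V) p f) \<in> P"
    and "cartesian_space U \<Longrightarrow> p \<in> points U \<rightarrow>\<^sub>E X \<Longrightarrow> good_open_cover U \<U> \<Longrightarrow>
      (\<And>W. W \<in> \<U> \<Longrightarrow> (open_submfd U W, restrict p W) \<in> P) \<Longrightarrow> (U, p) \<in> P"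
proof -
  note D = assms[unfolded diffeology_def]
  note D1 = D[THEN conjunct1] and D2 = D[THEN conjunct2, THEN conjunct1]
    and D3 = D[THEN conjunct2, THEN conjunct2, THEN conjunct1]
    and D4 = D[THEN conjunct2, THEN conjunct2, THEN conjunct2]
  show "cartesian_space U" "p \<in> points U \<rightarrow>\<^sub>E X" if "(U, p) \<in> P"
    using bspec[OF D1 that] by simp_all
  show "(U, p) \<in> P" if "smooth_manifold U" "diffeomorphic U (Rn 0)" "p \<in> points U \<rightarrow>\<^sub>E X"
    using D2[rule_format, of U p] that by simp
  show "(V, compose (points V) p f) \<in> P" if "(U, p) \<in> P" "cartesian_space V" "smooth_map V U f"
    using D3[rule_format, of U p V f] that by simp
  show "(U, p) \<in> P" if "cartesian_space U" "p \<in> points U \<rightarrow>\<^sub>E X" "good_open_cover U \<U>"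
    "\<And>W. W \<in> \<U> \<Longrightarrow> (open_submfd U W, restrict p W) \<in> P"
    using D4[THEN spec, THEN spec, THEN spec, of U p \<U>] that by simp
qed

lemma good_open_coverD:
  assumes "good_open_cover M \<U>"
  shows "\<Union>\<U> = points M" "W \<in> \<U> \<Longrightarrow> openin (mtop M) W"
    and "W \<in> \<U> \<Longrightarrow> cartesian_space (open_submfd M W)"
proof -
  note D = assms[unfolded good_open_cover_def]
  show "\<Union>\<U> = points M" using D[THEN conjunct2, THEN conjunct1] .
  show "openin (mtop M) W" "cartesian_space (open_submfd M W)" if "W \<in> \<U>"
    using bspec[OF conjunct1[OF D] that] by auto
qed

lemma diffeomorphic_R0_singleton:
  assumes "diffeomorphic U (Rn 0)"
  obtains u where "points U = {u}"
proof -
  obtain f g where fg: "smooth_map U (Rn 0) f" "smooth_map (Rn 0) U g" "\<And>x. x \<in> points U \<Longrightarrow> g (f x) = x"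
    using assms unfolding diffeomorphic_def by blast
  have E0: "E 0 = {\<lambda>i. 0}" by (auto simp: in_E_iff)
  have "x = g (\<lambda>i. 0)" if "x \<in> points U" for x
  proof -
    have "f x \<in> E 0" using smooth_map_image[OF fg(1) that] by simp
    then show ?thesis using fg(3)[OF that] unfolding E0 by simp
  qed
  moreover have "g (\<lambda>i. 0) \<in> points U"
    using smooth_map_image[OF fg(2), of "\<lambda>i. 0"] E0 by simp
  ultimately show ?thesis using that[of "g (\<lambda>i. 0)"] by blast
qed

section \<open>Both conversions produce diffeologies\<close>

text \<open>Pulled back along a test map, the members of a good cover become the open neighbourhoods
  that classical locality asks for. The axiom on points reduces to constant functions, as a map into
  a one-point space is constant.\<close>

lemma diffeology_diff_plots:
  assumes P: "classical_diffeology X P"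
  shows "diffeology X (diff_plots X P :: ('m mfd \<times> ('m \<Rightarrow> 'x)) set)"
proof -
  note D = classical_diffeologyD[OF P]
  let ?Q = "diff_plots X P :: ('m mfd \<times> ('m \<Rightarrow> 'x)) set"
  have pt: "(U, p) \<in> ?Q"
    if U: "smooth_manifold U" "diffeomorphic U (Rn 0)" and p: "p \<in> points U \<rightarrow>\<^sub>E X" for U p
    unfolding diff_plots_def mem_Collect_eq prod.case
  proof (intro conjI allI impI p)
    show "cartesian_space U" using U by (auto simp: cartesian_space_def)
    fix n V f assume V: "openin (Euclidean_space n) V \<and> smooth_map (open_Rn n V) U f"
    obtain u where u: "points U = {u}" using diffeomorphic_R0_singleton[OF U(2)] .
    have "compose V p f = (\<lambda>v\<in>V. p u)"
      using smooth_map_image[of "open_Rn n V" U f] V u points_open_Rn[of n V]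
      by (auto simp: compose_def fun_eq_iff restrict_def simp del: open_submfd_simps)
    then show "(n, V, compose V p f) \<in> P" using D(3)[of "p u"] V p u by auto
  qed
  have comp: "(V, compose (points V) p f) \<in> ?Q"
    if Up: "(U, p) \<in> ?Q" and V: "cartesian_space V" and f: "smooth_map V U f" for U p V f
    unfolding diff_plots_def mem_Collect_eq prod.case
  proof (intro conjI allI impI V)
    have fV: "f ` points V \<subseteq> points U" using smooth_map_image[OF f] by blast
    have "p \<in> points U \<rightarrow>\<^sub>E X" using Up by (simp add: diff_plots_def)
    then show "compose (points V) p f \<in> points V \<rightarrow>\<^sub>E X"
      by (rule compose_PiE[OF fV])
    fix n W g assume W: "openin (Euclidean_space n) W \<and> smooth_map (open_Rn n W) V g"
    then have "smooth_map (open_Rn n W) U (f \<circ> g)"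
      using smooth_map_compose[OF smooth_manifold_open_Rn _ _ _ f] V Up cartesian_space_manifold
      by (auto simp: diff_plots_def)
    moreover have "g ` W \<subseteq> points V"
      using W smooth_map_image[of "open_Rn n W" V g] points_open_Rn[of n W] by blast
    ultimately show "(n, W, compose W (compose (points V) p f) g) \<in> P"
      using Up W by (simp add: diff_plots_def compose_compose)
  qed
  have glue: "(U, p) \<in> ?Q"
    if U: "cartesian_space U" and p: "p \<in> points U \<rightarrow>\<^sub>E X" and cov: "good_open_cover U \<U>"
      and loc: "\<And>W. W \<in> \<U> \<Longrightarrow> (open_submfd U W, restrict p W) \<in> ?Q" for U p \<U>
    unfolding diff_plots_def mem_Collect_eq prod.case
  proof (intro conjI allI impI U p)
    fix n V f assume "openin (Euclidean_space n) V \<and> smooth_map (open_Rn n V) U f"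
    then have V: "openin (Euclidean_space n) V" and f: "smooth_map (open_Rn n V) U f" by auto
    have fV: "f ` V \<subseteq> points U" using smooth_map_image[OF f] points_open_Rn[OF V] by blast
    show "(n, V, compose V p f) \<in> P"
    proof (rule D(5)[OF V compose_PiE[OF fV p]])
      fix v assume v: "v \<in> V"
      have "f v \<in> \<Union>\<U>"
        unfolding good_open_coverD(1)[OF cov] using v fV by blast
      then obtain W where W: "W \<in> \<U>" "f v \<in> W" by (rule UnionE)
      have oW: "openin (mtop U) W" using good_open_coverD(2)[OF cov W(1)] .
      define V' where "V' = V \<inter> f -` W"
      have "openin (mtop (open_Rn n V)) V'"
        unfolding V'_def
        by (rule openin_Int_vimage[OF smooth_map_continuous[OF f] _ oW])
          (use V openin_subtopology_self in \<open>simp add: openin_open_subtopology\<close>)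
      then have V': "openin (Euclidean_space n) V'"
        using V openin_trans_full by simp
      have sub: "V' \<subseteq> V" and im: "f ` V' \<subseteq> W" by (auto simp: V'_def)
      \<comment> \<open>\<open>f\<close> sends \<open>V'\<close> into \<open>W\<close> and so
        becomes a test map for the plot on the submanifold \<open>W\<close>.\<close>
      have "smooth_map (open_Rn n V') U f"
        using smooth_map_from_open_submfd[OF f, of V'] by (simp only: open_submfd_open_submfd[OF sub])
      then have "smooth_map (open_Rn n V') (open_submfd U W) f"
        by (rule smooth_map_into_open_submfd) (use points_open_Rn[OF V'] im in simp)
      then have "(n, V', compose V' (restrict p W) f) \<in> P"
        using loc[OF W(1)] V' by (auto simp: diff_plots_def)
      then have "(n, V', restrict (compose V p f) V') \<in> P"
        using compose_restrict[OF sub im, of p] by simp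
      then show "\<exists>V'. openin (Euclidean_space n) V' \<and> v \<in> V' \<and> V' \<subseteq> V \<and> (n, V', restrict (compose V p f) V') \<in> P"
        using V' sub v W(2) by (intro exI[of _ V']) (auto simp: V'_def)
    qed
  qed
  have base: "\<forall>(U, p)\<in>?Q. cartesian_space U \<and> p \<in> points U \<rightarrow>\<^sub>E X"
    by (auto simp: diff_plots_def)
  show ?thesis
    unfolding diffeology_def
  proof (intro conjI base allI impI)
    fix U :: "'m mfd" and p assume "smooth_manifold U \<and> diffeomorphic U (Rn 0) \<and> p \<in> points U \<rightarrow>\<^sub>E X"
    then show "(U, p) \<in> ?Q" using pt by blast
  next
    fix U p and V :: "'m mfd" and f assume "(U, p) \<in> ?Q \<and> cartesian_space V \<and> smooth_map V U f"
    then show "(V, compose (points V) p f) \<in> ?Q" using comp by blast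
  next
    fix U p \<U> assume "cartesian_space U \<and> p \<in> points U \<rightarrow>\<^sub>E X \<and> good_open_cover U \<U> \<and>
      (\<forall>W\<in>\<U>. (open_submfd U W, restrict p W) \<in> ?Q)"
    then show "(U, p) \<in> ?Q" using glue[of U p \<U>] by blast
  qed
qed

text \<open>Locality is now given over arbitrary open sets, whereas \<open>P\<close> glues over good
  covers. A test map from a cartesian space \<open>V\<close> pulls the local plots back to an open
  cover of \<open>V\<close>, which \<open>good_open_cover_refinement\<close> replaces by a good
  one.\<close>

lemma classical_diffeology_classical_plots:
  assumes e: "inj (e :: (nat \<Rightarrow> real) \<Rightarrow> 'm)" and P: "diffeology X (P :: ('m mfd \<times> ('m \<Rightarrow> 'x)) set)"
  shows "classical_diffeology X (classical_plots X P)"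
proof -
  note D = diffeologyD[OF P]
  let ?Q = "classical_plots X P"
  have const: "(n, U, \<lambda>u\<in>U. c) \<in> ?Q" if c: "c \<in> X" and U: "openin (Euclidean_space n) U" for n U c
    unfolding classical_plots_def mem_Collect_eq prod.case
  proof (intro conjI allI impI U)
    show "(\<lambda>u\<in>U. c) \<in> U \<rightarrow>\<^sub>E X" using c by auto
    fix V :: "'m mfd" and f assume "cartesian_space V \<and> smooth_map V (open_Rn n U) f"
    then have V: "cartesian_space V" and f: "smooth_map V (open_Rn n U) f" by auto
    \<comment> \<open>The composite to be tested is constant, so it factors through a one-point
      cartesian space on \<open>'m\<close>, on which every function into \<open>X\<close> is a
      plot.\<close>
    obtain K :: "'m mfd" where K: "smooth_manifold K" "diffeomorphic K (Rn 0)"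
      using copy_of_Rn_exists[OF e] by blast
    obtain k where k: "points K = {k}" using diffeomorphic_R0_singleton[OF K(2)] .
    have "(K, \<lambda>x\<in>points K. c) \<in> P" by (rule D(3)[OF K]) (use c in auto)
    moreover have "smooth_map V K (\<lambda>x. k)"
      using smooth_map_const[OF cartesian_space_manifold[OF V] K(1)] k by simp
    ultimately have "(V, compose (points V) (\<lambda>x\<in>points K. c) (\<lambda>x. k)) \<in> P"
      by (rule D(4)[OF _ V])
    moreover have "compose (points V) (\<lambda>x\<in>points K. c) (\<lambda>x. k) = compose (points V) (\<lambda>u\<in>U. c) f"
      using smooth_map_image[OF f] points_open_Rn[OF U] k
      by (auto simp: compose_def restrict_def fun_eq_iff simp del: open_submfd_simps)
    ultimately show "(V, compose (points V) (\<lambda>u\<in>U. c) f) \<in> P" by simp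
  qed
  have comp: "(m, V, compose V p f) \<in> ?Q"
    if Up: "(n, U, p) \<in> ?Q" and V: "openin (Euclidean_space m) V" and f: "smooth_on m n V f" "f ` V \<subseteq> U"
    for n U p m V f
    unfolding classical_plots_def mem_Collect_eq prod.case
  proof (intro conjI allI impI V)
    have U: "openin (Euclidean_space n) U" using Up by (simp add: classical_plots_def)
    have "p \<in> U \<rightarrow>\<^sub>E X" using Up by (simp add: classical_plots_def)
    then show "compose V p f \<in> V \<rightarrow>\<^sub>E X"
      by (rule compose_PiE[OF f(2)])
    fix W :: "'m mfd" and g assume "cartesian_space W \<and> smooth_map W (open_Rn m V) g"
    then have W: "cartesian_space W" and g: "smooth_map W (open_Rn m V) g" by auto
    have "smooth_map (open_Rn m V) (open_Rn n U) f"
      using smooth_map_Rn_iff[OF V U] f by blast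
    then have "smooth_map W (open_Rn n U) (f \<circ> g)"
      using smooth_map_compose[OF cartesian_space_manifold[OF W] smooth_manifold_open_Rn[OF V]
          smooth_manifold_open_Rn[OF U] g] by blast
    moreover have "g ` points W \<subseteq> V"
      using smooth_map_image[OF g] points_open_Rn[OF V] by blast
    ultimately show "(W, compose (points W) (compose V p f) g) \<in> P"
      using Up W by (simp add: classical_plots_def compose_compose)
  qed
  have glue: "(n, U, p) \<in> ?Q"
    if U: "openin (Euclidean_space n) U" and p: "p \<in> U \<rightarrow>\<^sub>E X"
      and loc: "\<And>u. u \<in> U \<Longrightarrow> \<exists>A. openin (Euclidean_space n) A \<and> u \<in> A \<and> A \<subseteq> U \<and> (n, A, restrict p A) \<in> ?Q"
    for n U p
    unfolding classical_plots_def mem_Collect_eq prod.case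
  proof (intro conjI allI impI U p)
    fix V :: "'m mfd" and f assume "cartesian_space V \<and> smooth_map V (open_Rn n U) f"
    then have V: "cartesian_space V" and f: "smooth_map V (open_Rn n U) f" by auto
    have fV: "f ` points V \<subseteq> U" using smooth_map_image[OF f] points_open_Rn[OF U] by blast
    define \<A> where "\<A> = {A. openin (Euclidean_space n) A \<and> A \<subseteq> U \<and> (n, A, restrict p A) \<in> ?Q}"
    have open_vimage: "openin (mtop V) (points V \<inter> f -` A)" if "A \<in> \<A>" for A
      using that U
      by (intro openin_Int_vimage[OF smooth_map_continuous[OF f]])
        (auto simp: \<A>_def openin_open_subtopology)
    have "points V \<subseteq> \<Union>((\<lambda>A. points V \<inter> f -` A) ` \<A>)"
    proof
      fix x assume x: "x \<in> points V"
      then obtain A where "A \<in> \<A>" "f x \<in> A"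
        using loc[of "f x"] fV by (auto simp: \<A>_def)
      then show "x \<in> \<Union>((\<lambda>A. points V \<inter> f -` A) ` \<A>)" using x by blast
    qed
    then have cover: "\<Union>((\<lambda>A. points V \<inter> f -` A) ` \<A>) = points V" by blast
    have "openin (mtop V) B" if "B \<in> (\<lambda>A. points V \<inter> f -` A) ` \<A>" for B
      using that open_vimage by blast
    then obtain \<U> where \<U>: "good_open_cover V \<U>" "\<And>W. W \<in> \<U> \<Longrightarrow> \<exists>A\<in>(\<lambda>A. points V \<inter> f -` A) ` \<A>. W \<subseteq> A"
      using good_open_cover_refinement[OF V _ cover] by metis
    show "(V, compose (points V) p f) \<in> P"
    proof (rule D(5)[OF V compose_PiE[OF fV p] \<U>(1)])
      fix W assume W: "W \<in> \<U>"
      then obtain A where A: "A \<in> \<A>" "W \<subseteq> points V \<inter> f -` A" using \<U>(2) by blast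
      have oA: "openin (Euclidean_space n) A" "A \<subseteq> U" using A(1) by (auto simp: \<A>_def)
      have oW: "openin (mtop V) W" and cW: "cartesian_space (open_submfd V W)"
        using good_open_coverD(2,3)[OF \<U>(1) W] .
      have sub: "W \<subseteq> points V" and im: "f ` W \<subseteq> A" using A(2) by auto
      \<comment> \<open>Each member \<open>W\<close> of the refinement is sent into a single
        \<open>A\<close>, so \<open>f\<close> on \<open>W\<close> is a test map for the plot on
        \<open>A\<close>.\<close>
      have "smooth_map (open_submfd V W) (open_submfd (open_Rn n U) A) f"
        by (rule smooth_map_into_open_submfd[OF smooth_map_from_open_submfd[OF f]])
          (use im points_open_submfd[OF oW] in simp)
      then have "smooth_map (open_submfd V W) (open_Rn n A) f"
        by (simp only: open_submfd_open_submfd[OF oA(2)])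
      then have "(open_submfd V W, compose (points (open_submfd V W)) (restrict p A) f) \<in> P"
        using A(1) cW by (simp add: \<A>_def classical_plots_def del: open_submfd_simps)
      then show "(open_submfd V W, restrict (compose (points V) p f) W) \<in> P"
        using compose_restrict[OF sub im, of p] points_open_submfd[OF oW] by simp
    qed
  qed
  have base: "\<forall>(n, U, p)\<in>?Q. openin (Euclidean_space n) U \<and> p \<in> U \<rightarrow>\<^sub>E X"
    by (auto simp: classical_plots_def)
  show ?thesis
    unfolding classical_diffeology_def
  proof (intro conjI base allI ballI impI)
    fix n U c assume "c \<in> X" "openin (Euclidean_space n) U"
    then show "(n, U, \<lambda>u\<in>U. c) \<in> ?Q" by (rule const)
  next
    fix n U p m V f
    assume "(n, U, p) \<in> ?Q \<and> openin (Euclidean_space m) V \<and> smooth_on m n V f \<and> f ` V \<subseteq> U"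
    then show "(m, V, compose V p f) \<in> ?Q" using comp by blast
  next
    fix n U p
    assume "openin (Euclidean_space n) U \<and> p \<in> U \<rightarrow>\<^sub>E X \<and>
      (\<forall>u\<in>U. \<exists>V. openin (Euclidean_space n) V \<and> u \<in> V \<and> V \<subseteq> U \<and> (n, V, restrict p V) \<in> ?Q)"
    then show "(n, U, p) \<in> ?Q" using glue by blast
  qed
qed

section \<open>The conversions are mutually inverse\<close>

text \<open>One inclusion is closure under precomposition. For the other, the identity of a box is
  factored through a copy \<open>K\<close> of Euclidean space on \<open>'m\<close>: the test map
  from \<open>K\<close> turns \<open>p\<close> into a function on \<open>K\<close>, the test map
  into \<open>K\<close> brings it back to the box, and locality assembles the boxes.\<close>

lemma classical_plots_diff_plots:
  assumes e: "inj (e :: (nat \<Rightarrow> real) \<Rightarrow> 'm)" and P: "classical_diffeology X P"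
  shows "classical_plots X (diff_plots X P :: ('m mfd \<times> ('m \<Rightarrow> 'x)) set) = P"
proof -
  note D = classical_diffeologyD[OF P]
  let ?Q = "diff_plots X P :: ('m mfd \<times> ('m \<Rightarrow> 'x)) set"
  have "(n, U, p) \<in> classical_plots X ?Q" if Up: "(n, U, p) \<in> P" for n U p
    unfolding classical_plots_def mem_Collect_eq prod.case
  proof (intro conjI allI impI D(1,2)[OF Up])
    fix V :: "'m mfd" and f assume "cartesian_space V \<and> smooth_map V (open_Rn n U) f"
    then have V: "cartesian_space V" and f: "smooth_map V (open_Rn n U) f" by auto
    have U: "openin (Euclidean_space n) U" using D(1)[OF Up] .
    have fV: "f ` points V \<subseteq> U" using smooth_map_image[OF f] points_open_Rn[OF U] by blast
    show "(V, compose (points V) p f) \<in> ?Q"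
      unfolding diff_plots_def mem_Collect_eq prod.case
    proof (intro conjI allI impI V compose_PiE[OF fV D(2)[OF Up]])
      fix m W g assume "openin (Euclidean_space m) W \<and> smooth_map (open_Rn m W) V g"
      then have W: "openin (Euclidean_space m) W" and g: "smooth_map (open_Rn m W) V g" by auto
      have "smooth_map (open_Rn m W) (open_Rn n U) (f \<circ> g)"
        using smooth_map_compose[OF smooth_manifold_open_Rn[OF W] cartesian_space_manifold[OF V]
            smooth_manifold_open_Rn[OF U] g f] .
      then have "(m, W, compose W p (f \<circ> g)) \<in> P"
        using smooth_map_Rn_iff[OF W U] D(4)[OF Up W] by blast
      moreover have "g ` W \<subseteq> points V"
        using smooth_map_image[OF g] points_open_Rn[OF W] by blast
      ultimately show "(m, W, compose W (compose (points V) p f) g) \<in> P"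
        by (simp add: compose_compose)
    qed
  qed
  moreover have "(n, U, p) \<in> P" if "(n, U, p) \<in> classical_plots X ?Q" for n U p
  proof -
    have U: "openin (Euclidean_space n) U" and p: "p \<in> U \<rightarrow>\<^sub>E X"
      and plot: "\<And>V f. cartesian_space V \<Longrightarrow> smooth_map V (open_Rn n U) f \<Longrightarrow>
        (V, compose (points V) p f) \<in> ?Q"
      using that by (auto simp: classical_plots_def)
    show ?thesis
    proof (rule D(5)[OF U p])
      fix u assume u: "u \<in> U"
      \<comment> \<open>An open \<open>U\<close> need not be cartesian, so a box around
        \<open>u\<close> takes its place.\<close>
      obtain a b where ab: "u \<in> Box n a b" "Box n a b \<subseteq> U"
        using Box_neighbourhood[OF U u] .
      let ?B = "Box n a b"
      have "a i < b i" if "i < n" for i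
        using ab(1) that by (force simp: Box_def)
      then have "diffeomorphic (open_Rn n ?B) (Rn n)"
        by (rule diffeomorphic_Box_Rn)
      obtain K :: "'m mfd" where K: "smooth_manifold K" "diffeomorphic K (Rn n)"
        using copy_of_Rn_exists[OF e] by blast
      have sB: "smooth_manifold (open_Rn n ?B)"
        by (rule smooth_manifold_open_Rn[OF openin_Box])
      have "diffeomorphic (Rn n) (open_Rn n ?B)"
        using \<open>diffeomorphic (open_Rn n ?B) (Rn n)\<close> unfolding diffeomorphic_def by blast
      then have "diffeomorphic K (open_Rn n ?B)"
        using diffeomorphic_trans[OF K(1) smooth_manifold_Rn sB K(2)] by blast
      then obtain f g where fg: "smooth_map K (open_Rn n ?B) f" "smooth_map (open_Rn n ?B) K g"
          "\<And>y. y \<in> ?B \<Longrightarrow> f (g y) = y"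
        unfolding diffeomorphic_def points_open_Rn[OF openin_Box] by blast
      \<comment> \<open>A test map must have the submanifold \<open>U\<close> as its target, not the
        box. The target is widened to the whole space and then narrowed to \<open>U\<close>.\<close>
      have "smooth_map K (Rn n) f"
        using smooth_map_open_submfd_codomain[OF K(1) smooth_manifold_Rn _ fg(1)] openin_Box by simp
      moreover have "f ` points K \<subseteq> U"
        using smooth_map_image[OF fg(1)] points_open_Rn[OF openin_Box] ab(2) by blast
      ultimately have "smooth_map K (open_Rn n U) f"
        by (rule smooth_map_into_open_submfd)
      moreover have "cartesian_space K" using K by (auto simp: cartesian_space_def)
      ultimately have "(K, compose (points K) p f) \<in> ?Q" using plot by blast
      then have "(n, ?B, compose ?B (compose (points K) p f) g) \<in> P"
        using fg(2) openin_Box by (auto simp: diff_plots_def)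
      moreover have "compose ?B (compose (points K) p f) g = restrict p ?B"
      proof
        fix y
        show "compose ?B (compose (points K) p f) g y = restrict p ?B y"
          using fg(3)[of y] smooth_map_image[OF fg(2), of y] points_open_Rn[OF openin_Box]
          by (cases "y \<in> ?B") (simp_all add: compose_def del: open_submfd_simps)
      qed
      ultimately show "\<exists>V. openin (Euclidean_space n) V \<and> u \<in> V \<and> V \<subseteq> U \<and> (n, V, restrict p V) \<in> P"
        using ab openin_Box by (intro exI[of _ ?B]) simp
    qed
  qed
  ultimately show ?thesis by auto
qed

text \<open>A cartesian space is diffeomorphic to a Euclidean space as a whole, so a single test
  replaces gluing: \<open>p \<circ> g\<close> is a classical plot because \<open>g\<close> is a test
  map into \<open>U\<close>, and composing it with \<open>f\<close>, a test map from
  \<open>U\<close>, gives \<open>p\<close> back.\<close>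

lemma diff_plots_classical_plots:
  fixes P :: "('m mfd \<times> ('m \<Rightarrow> 'x)) set"
  assumes P: "diffeology X P"
  shows "diff_plots X (classical_plots X P) = P"
proof -
  note D = diffeologyD[OF P]
  have "(U, p) \<in> diff_plots X (classical_plots X P)" if Up: "(U, p) \<in> P" for U p
    unfolding diff_plots_def mem_Collect_eq prod.case
  proof (intro conjI allI impI D(1,2)[OF Up])
    fix n V f assume "openin (Euclidean_space n) V \<and> smooth_map (open_Rn n V) U f"
    then have V: "openin (Euclidean_space n) V" and f: "smooth_map (open_Rn n V) U f" by auto
    have fV: "f ` V \<subseteq> points U" using smooth_map_image[OF f] points_open_Rn[OF V] by blast
    show "(n, V, compose V p f) \<in> classical_plots X P"
      unfolding classical_plots_def mem_Collect_eq prod.case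
    proof (intro conjI allI impI V compose_PiE[OF fV D(2)[OF Up]])
      fix W :: "'m mfd" and g assume "cartesian_space W \<and> smooth_map W (open_Rn n V) g"
      then have W: "cartesian_space W" and g: "smooth_map W (open_Rn n V) g" by auto
      have "smooth_map W U (f \<circ> g)"
        using smooth_map_compose[OF cartesian_space_manifold[OF W] smooth_manifold_open_Rn[OF V]
            cartesian_space_manifold[OF D(1)[OF Up]] g f] .
      then have "(W, compose (points W) p (f \<circ> g)) \<in> P"
        by (rule D(4)[OF Up W])
      moreover have "g ` points W \<subseteq> V"
        using smooth_map_image[OF g] points_open_Rn[OF V] by blast
      ultimately show "(W, compose (points W) (compose V p f) g) \<in> P"
        by (simp add: compose_compose)
    qed
  qed
  moreover have "(U, p) \<in> P" if Up: "(U, p) \<in> diff_plots X (classical_plots X P)" for U p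
  proof -
    have U: "cartesian_space U" and p: "p \<in> points U \<rightarrow>\<^sub>E X"
      and plot: "\<And>n V f. openin (Euclidean_space n) V \<Longrightarrow> smooth_map (open_Rn n V) U f \<Longrightarrow>
        (n, V, compose V p f) \<in> classical_plots X P"
      using Up by (auto simp: diff_plots_def)
    obtain n f g where fg: "smooth_map U (Rn n) f" "smooth_map (Rn n) U g"
        "\<And>x. x \<in> points U \<Longrightarrow> g (f x) = x"
      using U unfolding cartesian_space_def diffeomorphic_def by blast
    have "(n, E n, compose (E n) p g) \<in> classical_plots X P"
      by (rule plot) (use fg(2) in \<open>simp_all only: open_submfd_Rn_E openin_topspace\<close>)
    then have "(U, compose (points U) (compose (E n) p g) f) \<in> P"
      using U fg(1) by (simp add: classical_plots_def open_submfd_Rn_E)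
    moreover have "compose (points U) (compose (E n) p g) f = p"
      using fg(3) smooth_map_image[OF fg(1)] p
      by (auto simp: compose_def restrict_def fun_eq_iff PiE_def extensional_def)
    ultimately show ?thesis by simp
  qed
  ultimately show ?thesis by auto
qed

subsection \<open>The equivalence\<close>

lemma Diff_simps:
  "Obj Diff = {A. diffeology (fst A) (snd A)}"
  "Hom Diff A B = {f \<in> fst A \<rightarrow>\<^sub>E fst B. \<forall>(U, p)\<in>snd A. (U, compose (points U) f p) \<in> snd B}"
  "Idn Diff A = (\<lambda>x\<in>fst A. x)"
  "Comp Diff A B C g f = compose (fst A) g f"
  by (auto simp: Diff_def split_beta)

lemma classical_Diff_simps:
  "Obj classical_Diff = {A. classical_diffeology (fst A) (snd A)}"
  "Hom classical_Diff A B = {f \<in> fst A \<rightarrow>\<^sub>E fst B. \<forall>(n, U, p)\<in>snd A. (n, U, compose U f p) \<in> snd B}"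
  "Idn classical_Diff A = (\<lambda>x\<in>fst A. x)"
  "Comp classical_Diff A B C g f = compose (fst A) g f"
  by (auto simp: classical_Diff_def split_beta)

lemma compose_restrict_id: "p \<in> A \<rightarrow>\<^sub>E X \<Longrightarrow> compose A (\<lambda>x\<in>X. x) p = p"
  by (auto simp: compose_def fun_eq_iff PiE_def extensional_def)

lemma compose_id_restrict: "p \<in> A \<rightarrow>\<^sub>E X \<Longrightarrow> compose A p (\<lambda>x\<in>A. x) = p"
  by (auto simp: compose_def fun_eq_iff PiE_def extensional_def)

lemma compose_assoc_PiE:
  "p \<in> A \<rightarrow>\<^sub>E X \<Longrightarrow> compose A (compose X g f) p = compose A g (compose A f p)"
  by (auto simp: compose_def fun_eq_iff)

lemma category_Diff: "category (Diff :: ('x set \<times> ('m mfd \<times> ('m \<Rightarrow> 'x)) set, 'x \<Rightarrow> 'x) cat)"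
  unfolding category_def Diff_simps
proof (intro conjI ballI)
  fix A :: "'x set \<times> ('m mfd \<times> ('m \<Rightarrow> 'x)) set" assume "A \<in> {A. diffeology (fst A) (snd A)}"
  then show "(\<lambda>x\<in>fst A. x) \<in> {f \<in> fst A \<rightarrow>\<^sub>E fst A. \<forall>(U, p)\<in>snd A. (U, compose (points U) f p) \<in> snd A}"
    using diffeologyD(2)[of "fst A" "snd A"] by (auto simp: compose_restrict_id)
next
  fix A B C :: "'x set \<times> ('m mfd \<times> ('m \<Rightarrow> 'x)) set" and f g
  assume A: "A \<in> {A. diffeology (fst A) (snd A)}"
    and fg: "f \<in> {f \<in> fst A \<rightarrow>\<^sub>E fst B. \<forall>(U, p)\<in>snd A. (U, compose (points U) f p) \<in> snd B}"
      "g \<in> {f \<in> fst B \<rightarrow>\<^sub>E fst C. \<forall>(U, p)\<in>snd B. (U, compose (points U) f p) \<in> snd C}"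
  have "(U, compose (points U) (compose (fst A) g f) p) \<in> snd C" if Up: "(U, p) \<in> snd A" for U p
  proof -
    \<comment> \<open>Composites here are cut down to their domains; reassociating them requires
      that \<open>p\<close> take its values in the carrier.\<close>
    have "p \<in> points U \<rightarrow>\<^sub>E fst A"
      using diffeologyD(2)[OF _ Up] A by simp
    then have "compose (points U) (compose (fst A) g f) p = compose (points U) g (compose (points U) f p)"
      by (rule compose_assoc_PiE)
    moreover have "(U, compose (points U) f p) \<in> snd B" using fg(1) Up by auto
    then have "(U, compose (points U) g (compose (points U) f p)) \<in> snd C" using fg(2) by auto
    ultimately show ?thesis by simp
  qed
  moreover have "compose (fst A) g f \<in> fst A \<rightarrow>\<^sub>E fst C"
    by (rule compose_PiE[of f _ "fst B"]) (use fg in auto)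
  ultimately show "compose (fst A) g f \<in> {f \<in> fst A \<rightarrow>\<^sub>E fst C. \<forall>(U, p)\<in>snd A. (U, compose (points U) f p) \<in> snd C}"
    by blast
qed (auto simp: compose_restrict_id compose_id_restrict compose_assoc_PiE)

lemma category_classical_Diff:
  "category (classical_Diff :: ('x set \<times> (nat \<times> (nat \<Rightarrow> real) set \<times> ((nat \<Rightarrow> real) \<Rightarrow> 'x)) set, 'x \<Rightarrow> 'x) cat)"
  unfolding category_def classical_Diff_simps
proof (intro conjI ballI)
  fix A :: "'x set \<times> (nat \<times> (nat \<Rightarrow> real) set \<times> ((nat \<Rightarrow> real) \<Rightarrow> 'x)) set"
  assume "A \<in> {A. classical_diffeology (fst A) (snd A)}"
  then show "(\<lambda>x\<in>fst A. x) \<in> {f \<in> fst A \<rightarrow>\<^sub>E fst A. \<forall>(n, U, p)\<in>snd A. (n, U, compose U f p) \<in> snd A}"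
    using classical_diffeologyD(2)[of "fst A" "snd A"] by (auto simp: compose_restrict_id)
next
  fix A B C :: "'x set \<times> (nat \<times> (nat \<Rightarrow> real) set \<times> ((nat \<Rightarrow> real) \<Rightarrow> 'x)) set" and f g
  assume A: "A \<in> {A. classical_diffeology (fst A) (snd A)}"
    and fg: "f \<in> {f \<in> fst A \<rightarrow>\<^sub>E fst B. \<forall>(n, U, p)\<in>snd A. (n, U, compose U f p) \<in> snd B}"
      "g \<in> {f \<in> fst B \<rightarrow>\<^sub>E fst C. \<forall>(n, U, p)\<in>snd B. (n, U, compose U f p) \<in> snd C}"
  have "(n, U, compose U (compose (fst A) g f) p) \<in> snd C" if Up: "(n, U, p) \<in> snd A" for n U p
  proof -
    have "p \<in> U \<rightarrow>\<^sub>E fst A"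
      using classical_diffeologyD(2)[OF _ Up] A by simp
    then have "compose U (compose (fst A) g f) p = compose U g (compose U f p)"
      by (rule compose_assoc_PiE)
    moreover have "(n, U, compose U f p) \<in> snd B" using fg(1) Up by auto
    then have "(n, U, compose U g (compose U f p)) \<in> snd C" using fg(2) by auto
    ultimately show ?thesis by simp
  qed
  moreover have "compose (fst A) g f \<in> fst A \<rightarrow>\<^sub>E fst C"
    by (rule compose_PiE[of f _ "fst B"]) (use fg in auto)
  ultimately show "compose (fst A) g f \<in> {f \<in> fst A \<rightarrow>\<^sub>E fst C. \<forall>(n, U, p)\<in>snd A. (n, U, compose U f p) \<in> snd C}"
    by blast
qed (auto simp: compose_restrict_id compose_id_restrict compose_assoc_PiE)

text \<open>Identity arrows are the components. Agreement with the identity on objects is asked only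
  inside \<open>Obj C\<close>, because the round trips restore genuine diffeologies and not
  arbitrary sets of plots.\<close>

lemma natural_iso_Idn:
  assumes C: "category C"
    and obj: "\<And>X. X \<in> Obj C \<Longrightarrow> FObj F X = X" "\<And>X. X \<in> Obj C \<Longrightarrow> FObj G X = X"
    and arr: "\<And>X Y f. FArr F X Y f = f" "\<And>X Y f. FArr G X Y f = f"
  shows "natural_iso C C F G (Idn C)"
proof -
  have id: "Idn C X \<in> Hom C X X" if "X \<in> Obj C" for X
    using C that by (simp add: category_def)
  have unit: "Comp C X X Y f (Idn C X) = f" "Comp C X Y Y (Idn C Y) f = f"
    if "X \<in> Obj C" "Y \<in> Obj C" "f \<in> Hom C X Y" for X Y f
    using C that by (simp_all add: category_def)
  show ?thesis
    unfolding natural_iso_def is_iso_def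
  proof (intro conjI ballI)
    fix X assume X: "X \<in> Obj C"
    then show "Idn C X \<in> Hom C (FObj F X) (FObj G X)" using id obj by simp
    show "\<exists>g\<in>Hom C (FObj G X) (FObj F X).
        Comp C (FObj F X) (FObj G X) (FObj F X) g (Idn C X) = Idn C (FObj F X) \<and>
        Comp C (FObj G X) (FObj F X) (FObj G X) (Idn C X) g = Idn C (FObj G X)"
      using X id obj unit by (intro bexI[of _ "Idn C X"]) simp_all
  next
    fix X Y f assume "X \<in> Obj C" "Y \<in> Obj C" "f \<in> Hom C X Y"
    then show "Comp C (FObj F X) (FObj F Y) (FObj G Y) (Idn C Y) (FArr F X Y f) =
        Comp C (FObj F X) (FObj G X) (FObj G Y) (FArr G X Y f) (Idn C X)"
      using obj arr unit by simp
  qed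
qed

text \<open>Composing with \<open>f\<close> after a plot commutes with composing a test map before
  it. This and the next lemma let both functors keep the underlying functions of morphisms.\<close>

lemma compose_diff_plots:
  assumes f: "f \<in> X \<rightarrow>\<^sub>E Y" "\<And>n U p. (n, U, p) \<in> P \<Longrightarrow> (n, U, compose U f p) \<in> Q"
    and Up: "(U, p) \<in> diff_plots X P"
  shows "(U, compose (points U) f p) \<in> diff_plots Y Q"
  unfolding diff_plots_def mem_Collect_eq prod.case
proof (intro conjI allI impI)
  have p: "p \<in> points U \<rightarrow>\<^sub>E X" using Up by (simp add: diff_plots_def)
  show "cartesian_space U" using Up by (simp add: diff_plots_def)
  show "compose (points U) f p \<in> points U \<rightarrow>\<^sub>E Y"
    using compose_PiE[of p "points U" X f] p f(1) by auto
  fix n V g assume V: "openin (Euclidean_space n) V \<and> smooth_map (open_Rn n V) U g"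
  then have "g ` V \<subseteq> points U"
    using smooth_map_image[of "open_Rn n V" U g] points_open_Rn[of n V] by blast
  then have "compose V (compose (points U) f p) g = compose V f (compose V p g)"
    by (auto simp: compose_def fun_eq_iff restrict_def)
  then show "(n, V, compose V (compose (points U) f p) g) \<in> Q"
    using V Up f(2) by (simp add: diff_plots_def)
qed

lemma compose_classical_plots:
  fixes P :: "('m mfd \<times> ('m \<Rightarrow> 'x)) set"
  assumes f: "f \<in> X \<rightarrow>\<^sub>E Y" "\<And>U p. (U, p) \<in> P \<Longrightarrow> (U, compose (points U) f p) \<in> Q"
    and Up: "(n, U, p) \<in> classical_plots X P"
  shows "(n, U, compose U f p) \<in> classical_plots Y Q"
  unfolding classical_plots_def mem_Collect_eq prod.case
proof (intro conjI allI impI)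
  have p: "p \<in> U \<rightarrow>\<^sub>E X" using Up by (simp add: classical_plots_def)
  show U: "openin (Euclidean_space n) U" using Up by (simp add: classical_plots_def)
  show "compose U f p \<in> U \<rightarrow>\<^sub>E Y"
    using compose_PiE[of p U X f] p f(1) by auto
  fix V :: "'m mfd" and g assume V: "cartesian_space V \<and> smooth_map V (open_Rn n U) g"
  then have "g ` points V \<subseteq> U"
    using smooth_map_image[of V "open_Rn n U" g] points_open_Rn[OF U] by blast
  then have "compose (points V) (compose U f p) g = compose (points V) f (compose (points V) p g)"
    by (auto simp: compose_def fun_eq_iff restrict_def)
  then show "(V, compose (points V) (compose U f p) g) \<in> Q"
    using V Up f(2) by (simp add: classical_plots_def)
qed

theorem propositionA18:
  assumes "\<exists>e :: (nat \<Rightarrow> real) \<Rightarrow> 'm. inj e"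
  shows "equivalent_categories
           (classical_Diff :: ('x set \<times> (nat \<times> (nat \<Rightarrow> real) set \<times> ((nat \<Rightarrow> real) \<Rightarrow> 'x)) set, 'x \<Rightarrow> 'x) cat)
           (Diff :: ('x set \<times> ('m mfd \<times> ('m \<Rightarrow> 'x)) set, 'x \<Rightarrow> 'x) cat)"
proof -
  let ?C = "classical_Diff :: ('x set \<times> (nat \<times> (nat \<Rightarrow> real) set \<times> ((nat \<Rightarrow> real) \<Rightarrow> 'x)) set, 'x \<Rightarrow> 'x) cat"
  let ?D = "Diff :: ('x set \<times> ('m mfd \<times> ('m \<Rightarrow> 'x)) set, 'x \<Rightarrow> 'x) cat"
  obtain e :: "(nat \<Rightarrow> real) \<Rightarrow> 'm" where e: "inj e" using assms by blast
  define F :: "('x set \<times> (nat \<times> (nat \<Rightarrow> real) set \<times> ((nat \<Rightarrow> real) \<Rightarrow> 'x)) set, 'x \<Rightarrow> 'x,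
      'x set \<times> ('m mfd \<times> ('m \<Rightarrow> 'x)) set, 'x \<Rightarrow> 'x) ftor"
    where "F = \<lparr>FObj = (\<lambda>A. (fst A, diff_plots (fst A) (snd A))), FArr = (\<lambda>A B f. f)\<rparr>"
  define G :: "('x set \<times> ('m mfd \<times> ('m \<Rightarrow> 'x)) set, 'x \<Rightarrow> 'x,
      'x set \<times> (nat \<times> (nat \<Rightarrow> real) set \<times> ((nat \<Rightarrow> real) \<Rightarrow> 'x)) set, 'x \<Rightarrow> 'x) ftor"
    where "G = \<lparr>FObj = (\<lambda>A. (fst A, classical_plots (fst A) (snd A))), FArr = (\<lambda>A B f. f)\<rparr>"
  \<comment> \<open>Identities and composites are given by the same formulas in both categories and
    depend on the carriers alone, so only the preservation of plots has content.\<close>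
  have "is_functor ?C ?D F"
    unfolding is_functor_def
  proof (intro conjI ballI)
    fix A B f assume "f \<in> Hom ?C A B"
    then have f: "f \<in> fst A \<rightarrow>\<^sub>E fst B" "\<And>n U p. (n, U, p) \<in> snd A \<Longrightarrow> (n, U, compose U f p) \<in> snd B"
      by (auto simp: classical_Diff_simps)
    have "(U, compose (points U) f p) \<in> diff_plots (fst B) (snd B)" if "(U, p) \<in> diff_plots (fst A) (snd A)" for U p
      by (rule compose_diff_plots[OF f that])
    then show "FArr F A B f \<in> Hom ?D (FObj F A) (FObj F B)"
      using f(1) by (auto simp: F_def Diff_simps)
  qed (auto simp: F_def classical_Diff_simps Diff_simps diffeology_diff_plots)
  moreover have "is_functor ?D ?C G"
    unfolding is_functor_def
  proof (intro conjI ballI)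
    fix A B f assume "f \<in> Hom ?D A B"
    then have f: "f \<in> fst A \<rightarrow>\<^sub>E fst B" "\<And>U p. (U, p) \<in> snd A \<Longrightarrow> (U, compose (points U) f p) \<in> snd B"
      by (auto simp: Diff_simps)
    have "(n, U, compose U f p) \<in> classical_plots (fst B) (snd B)" if "(n, U, p) \<in> classical_plots (fst A) (snd A)" for n U p
      by (rule compose_classical_plots[OF f that])
    then show "FArr G A B f \<in> Hom ?C (FObj G A) (FObj G B)"
      using f(1) by (auto simp: G_def classical_Diff_simps)
  qed (auto simp: G_def classical_Diff_simps Diff_simps classical_diffeology_classical_plots[OF e])
  moreover have "natural_iso ?C ?C id_ftor (comp_ftor G F) (Idn ?C)"
    by (rule natural_iso_Idn[OF category_classical_Diff])
      (auto simp: id_ftor_def comp_ftor_def F_def G_def classical_Diff_simps classical_plots_diff_plots[OF e])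
  moreover have "natural_iso ?D ?D (comp_ftor F G) id_ftor (Idn ?D)"
    by (rule natural_iso_Idn[OF category_Diff])
      (auto simp: id_ftor_def comp_ftor_def F_def G_def Diff_simps diff_plots_classical_plots)
  ultimately show ?thesis
    unfolding equivalent_categories_def using category_Diff category_classical_Diff by blast
qed

end
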